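(* Let $\mathcal T$ be a staged tree and let $\mathcal S$ be a subtree of $\mathcal T$ with the same root as $\mathcal T$. Let $v_1,\dots,v_m$ denote the vertices of $\mathcal T$ which are leaves of the subtree $\mathcal S$. Suppose that 1. the tree $\mathcal S$ is balanced, 2. no internal vertex of $\mathcal S$ is in the same stage as a vertex in some $\mathcal T(v_i)$, 3. the stages of vertices in $\mathcal T(v_1),\dots,\mathcal T(v_m)$ satisfy the subtree-inclusion property. Then $\mathcal T$ has toric structure.
   Context: A staged tree $\mathcal T$ is a finite rooted tree, edges directed away from the root, with an equivalence relation $\sim$ on vertices (classes are called stages or colours) and edge labels $\theta(e)$ such that: the outgoing edges of an inner vertex have pairwise distinct labels; inner vertices in the same stage have the same set of outgoing edge labels; inner vertices in different stages have disjoint sets of outgoing labels; leaves are (by convention) all in the same stage. Labels stand for probabilities in $(0,1)$ summing to one at each inner vertex, so each inner vertex has at least two children. The children of a vertex $v$ are written $v_1,\dots,v_k$, ordered such that if $u\sim v$ is a stage with labels $\theta_1,\dots,\theta_k$, then the edges $(u,u_i)$ and $(v,v_i)$ both have label $\theta_i$. $\lambda_1,\dots,\lambda_n$ are the root-to-leaf paths, $E(\lambda_r)$ is the set of edges of $\lambda_r$, $d(\lambda_r)=|E(\lambda_r)|$, and $d=\max_r d(\lambda_r)$. $\mathcal T(v)$ denotes the induced subtree of $\mathcal T$ rooted at $v$ (all vertices below $v$, with their labels and stages). A subtree $\mathcal S$ with the same root as $\mathcal T$ is a staged tree obtained from $\mathcal T$ by choosing some vertices and deleting everything below them, so that these vertices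 become leaves; each inner vertex of $\mathcal S$ keeps all its children, its labels and its stage. For a vertex $v$ of a staged tree, $t(v)\in\mathbb R[\Theta]$ is the sum over all $v$-to-leaf paths of the product of the labels along the path ($t(v)=1$ for a leaf). A staged tree is balanced if for any two vertices $u\sim v$ in the same stage, $t(u_i)t(v_j)=t(u_j)t(v_i)$ for all $i,j=1,\dots,k$. A stage $c$ (of inner vertices) of $\mathcal T$ has the subtree-inclusion property if there is an index $i_c$ such that for every vertex $v$ of stage $c$ and every child $v_i$ of $v$, the tree $\mathcal T(v_i)$ contains a subtree with root $v_i$ that is identical (as a labelled rooted tree) to $\mathcal T(v_{i_c})$. Treat the set $\Theta$ of labels as variables, let $z$ be one extra variable, and let $\langle\theta-z\rangle\subset\mathbb R[\Theta,z]$ be the ideal generated by $\sum_{e\in E(v)}\theta(e)-z$ for all inner vertices $v$ of $\mathcal T$, where $E(v)$ is the set of outgoing edges of $v$. Define the $\mathbb R$-algebra map $$\varphi_{\mathcal T}:\mathbb R[p_1,\dots,p_n]\to\mathbb R[\Theta,z]/\langle\theta-z\rangle,\qquad p_r\mapsto z^{d-d(\lambda_r)}\prod_{e\in E(\lambda_r)}\theta(e).$$ $\mathcal T$ has toric structure if $\ker\varphi_{\mathcal T}$ is toric after a linear change of variables, i.e. there is a basis $\ell_1,\dots,\ell_n$ of the space of linear forms of $\mathbb R[p_1,\dots,p_n]$ such that $\ker\varphi_{\mathcal T}$ is the kernel of an $\mathbb R$-algebra map $\mathbb R[\ell_1,\dots,\ell_n]\to\mathbb R[y_1^{\pm1},\dots,y_N^{\pm1}]$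 sending each $\ell_i$ to a Laurent monomial. *)

theory Defs
  imports Complex_Main "HOL-Library.Poly_Mapping" "HOL-Algebra.QuotRing"
begin

section \<open>Staged trees\<close>

text \<open>
  A finite rooted tree with coloured inner vertices and labelled edges. The list of
  children of a vertex is its ordered list of children together with the labels of the
  edges leading to them. Since all leaves are in one common stage, which contains no
  inner vertex, no colour is stored at a leaf.
\<close>

datatype ('c, 'l) stree = Leaf | Node 'c "('l \<times> ('c, 'l) stree) list"

text \<open>
  Vertices are addressed by the sequence of child indices (counted from 0) on the path
  from the root; \<open>v @ [i]\<close> is the \<open>i\<close>-th child of \<open>v\<close>, and \<open>v\<close> itself is also used as the
  name of the path from the root to \<open>v\<close>.
\<close>

type_synonym vertex = "nat list"

fun is_vertex :: "('c, 'l) stree \<Rightarrow> vertex \<Rightarrow> bool" where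
  "is_vertex T [] = True"
| "is_vertex Leaf (i # v) = False"
| "is_vertex (Node c ts) (i # v) = (i < length ts \<and> is_vertex (snd (ts ! i)) v)"

definition vertices :: "('c, 'l) stree \<Rightarrow> vertex set" where
  "vertices T = {v. is_vertex T v}"

text \<open>The induced subtree \<open>\<T>(v)\<close>; the value is only meaningful for vertices \<open>v\<close> of \<open>T\<close>.\<close>

fun subtree_at :: "('c, 'l) stree \<Rightarrow> vertex \<Rightarrow> ('c, 'l) stree" where
  "subtree_at T [] = T"
| "subtree_at Leaf (i # v) = Leaf"
| "subtree_at (Node c ts) (i # v) = subtree_at (snd (ts ! i)) v"

definition leaves :: "('c, 'l) stree \<Rightarrow> vertex set" where
  "leaves T = {v \<in> vertices T. subtree_at T v = Leaf}"

definition inner_vertices :: "('c, 'l) stree \<Rightarrow> vertex set" where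
  "inner_vertices T = {v \<in> vertices T. subtree_at T v \<noteq> Leaf}"

text \<open>
  The stage of a vertex: \<open>u \<sim> v\<close> in \<open>T\<close> is \<open>stage T u = stage T v\<close>. The value \<open>None\<close> is
  the stage consisting of the leaves.
\<close>

definition stage :: "('c, 'l) stree \<Rightarrow> vertex \<Rightarrow> 'c option" where
  "stage T v = (case subtree_at T v of Leaf \<Rightarrow> None | Node c ts \<Rightarrow> Some c)"

text \<open>The labels of the outgoing edges of \<open>v\<close>, in the order of the children of \<open>v\<close>.\<close>

definition out_labels :: "('c, 'l) stree \<Rightarrow> vertex \<Rightarrow> 'l list" where
  "out_labels T v = (case subtree_at T v of Leaf \<Rightarrow> [] | Node c ts \<Rightarrow> map fst ts)"

definition num_children :: "('c, 'l) stree \<Rightarrow> vertex \<Rightarrow> nat" where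
  "num_children T v = length (out_labels T v)"

text \<open>
  In the second condition the label lists (not only the label sets) of vertices in the
  same stage agree: this is the convention that children are ordered compatibly with
  the stages.
\<close>

definition staged_tree :: "('c, 'l) stree \<Rightarrow> bool" where
  "staged_tree T \<longleftrightarrow>
     (\<forall>v\<in>inner_vertices T. distinct (out_labels T v) \<and> num_children T v \<ge> 2) \<and>
     (\<forall>u\<in>inner_vertices T. \<forall>v\<in>inner_vertices T.
        stage T u = stage T v \<longrightarrow> out_labels T u = out_labels T v) \<and>
     (\<forall>u\<in>inner_vertices T. \<forall>v\<in>inner_vertices T.
        stage T u \<noteq> stage T v \<longrightarrow> set (out_labels T u) \<inter> set (out_labels T v) = {})"

text \<open>
  \<open>S\<close> arises from \<open>T\<close> by deleting everything below some vertices: every inner vertex of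
  \<open>S\<close> keeps its stage, its labels and (as the label lists have the same length) all its
  children, while a leaf of \<open>S\<close> may be any vertex of \<open>T\<close>.
\<close>

definition rooted_subtree :: "('c, 'l) stree \<Rightarrow> ('c, 'l) stree \<Rightarrow> bool" where
  "rooted_subtree S T \<longleftrightarrow>
     vertices S \<subseteq> vertices T \<and>
     (\<forall>v\<in>inner_vertices S. stage S v = stage T v \<and> out_labels S v = out_labels T v)"

definition has_subtree_inclusion :: "('c, 'l) stree \<Rightarrow> 'c \<Rightarrow> bool" where
  "has_subtree_inclusion T c \<longleftrightarrow>
     (\<exists>i\<^sub>c. \<forall>v\<in>vertices T. stage T v = Some c \<longrightarrow>
        i\<^sub>c < num_children T v \<and>
        (\<forall>i<num_children T v.
           \<exists>S. rooted_subtree S (subtree_at T (v @ [i])) \<and> S = subtree_at T (v @ [i\<^sub>c])))"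

text \<open>The sequence of edge labels on the path from the root to \<open>v\<close>.\<close>

fun path_labels :: "('c, 'l) stree \<Rightarrow> vertex \<Rightarrow> 'l list" where
  "path_labels (Node c ts) (i # v) = fst (ts ! i) # path_labels (snd (ts ! i)) v"
| "path_labels T v = []"

section \<open>Polynomial and Laurent polynomial rings over the reals\<close>

text \<open>
  Monomials in variables from \<open>'x\<close> are finitely supported exponent functions
  \<open>'x \<Rightarrow>\<^sub>0 'e\<close>: \<open>'e = nat\<close> gives polynomials and \<open>'e = int\<close> Laurent polynomials. The
  addition of exponents is the multiplication of monomials.
\<close>

type_synonym ('x, 'e) pol = "('x \<Rightarrow>\<^sub>0 'e) \<Rightarrow>\<^sub>0 real"

definition const :: "real \<Rightarrow> ('x, 'e::comm_monoid_add) pol" where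
  "const c = Poly_Mapping.single 0 c"

definition monomial :: "('x \<Rightarrow>\<^sub>0 'e::comm_monoid_add) \<Rightarrow> ('x, 'e) pol" where
  "monomial m = Poly_Mapping.single m 1"

definition var :: "'x \<Rightarrow> ('x, nat) pol" where
  "var x = monomial (Poly_Mapping.single x 1)"

definition pol_ring :: "'x set \<Rightarrow> ('x, 'e::comm_monoid_add) pol ring" where
  "pol_ring X =
     \<lparr>carrier = {f. \<forall>m\<in>Poly_Mapping.keys f. Poly_Mapping.keys m \<subseteq> X},
      mult = (*), one = 1, zero = 0, add = (+)\<rparr>"

definition scale :: "real \<Rightarrow> ('x, 'e::comm_monoid_add) pol \<Rightarrow> ('x, 'e) pol" where
  "scale c f = const c * f"

global_interpretation pol: vector_space scale
proof
  fix a b :: real and f g :: "('x, 'e::comm_monoid_add) pol"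
  show "scale a (f + g) = scale a f + scale a g"
    by (simp add: scale_def distrib_left)
  show "scale (a + b) f = scale a f + scale b f"
    by (simp add: scale_def const_def single_add distrib_right)
  show "scale a (scale b f) = scale (a * b) f"
    by (simp add: scale_def const_def mult_single flip: mult.assoc)
  show "scale 1 f = f"
    by (simp add: scale_def const_def)
qed

definition alg_hom ::
    "('x, 'e::comm_monoid_add) pol ring \<Rightarrow> ('y, 'f::comm_monoid_add) pol ring \<Rightarrow>
     (('x, 'e) pol \<Rightarrow> ('y, 'f) pol) set" where
  "alg_hom A B = {\<psi> \<in> ring_hom A B. \<forall>c. \<psi> (const c) = const c}"

text \<open>Substitution of \<open>g x\<close> for each variable \<open>x\<close>, i.e. the algebra map with \<open>x \<mapsto> g x\<close>.\<close>

definition substitute :: "('x \<Rightarrow> ('y, nat) pol) \<Rightarrow> ('x, nat) pol \<Rightarrow> ('y, nat) pol" where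
  "substitute g f =
     (\<Sum>m\<in>Poly_Mapping.keys f. const (Poly_Mapping.lookup f m) *
        (\<Prod>x\<in>Poly_Mapping.keys m. g x ^ Poly_Mapping.lookup m x))"

section \<open>Balanced staged trees\<close>

text \<open>The polynomial \<open>t(v)\<close> of the root \<open>v\<close> of the given tree.\<close>

definition tree_pol :: "('c, 'l) stree \<Rightarrow> ('l, nat) pol" where
  "tree_pol T = (\<Sum>r\<in>leaves T. prod_list (map var (path_labels T r)))"

definition balanced :: "('c, 'l) stree \<Rightarrow> bool" where
  "balanced T \<longleftrightarrow>
     (\<forall>u\<in>vertices T. \<forall>v\<in>vertices T. stage T u = stage T v \<longrightarrow>
        (\<forall>i<num_children T v. \<forall>j<num_children T v.
           tree_pol (subtree_at T (u @ [i])) * tree_pol (subtree_at T (v @ [j])) =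
           tree_pol (subtree_at T (u @ [j])) * tree_pol (subtree_at T (v @ [i]))))"

section \<open>Toric structure\<close>

datatype 'l param = Lab 'l | Z

definition label_set :: "('c, 'l) stree \<Rightarrow> 'l set" where
  "label_set T = (\<Union>v\<in>inner_vertices T. set (out_labels T v))"

definition param_ring :: "('c, 'l) stree \<Rightarrow> ('l param, nat) pol ring" where
  "param_ring T = pol_ring (insert Z (Lab ` label_set T))"

definition sum_ideal :: "('c, 'l) stree \<Rightarrow> ('l param, nat) pol set" where
  "sum_ideal T = Idl\<^bsub>param_ring T\<^esub>
     {(\<Sum>l\<leftarrow>out_labels T v. var (Lab l)) - var Z | v. v \<in> inner_vertices T}"

definition depth :: "('c, 'l) stree \<Rightarrow> nat" where
  "depth T = Max (length ` leaves T)"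

text \<open>
  The variables \<open>p\<^sub>1, \<dots>, p\<^sub>n\<close> are indexed by the leaves of \<open>T\<close>, which stand for the
  root-to-leaf paths.
\<close>

definition leaf_ring :: "('c, 'l) stree \<Rightarrow> (vertex, nat) pol ring" where
  "leaf_ring T = pol_ring (leaves T)"

definition path_image :: "('c, 'l) stree \<Rightarrow> vertex \<Rightarrow> ('l param, nat) pol" where
  "path_image T r =
     var Z ^ (depth T - length r) * prod_list (map (\<lambda>l. var (Lab l)) (path_labels T r))"

definition tree_map :: "('c, 'l) stree \<Rightarrow> (vertex, nat) pol \<Rightarrow> ('l param, nat) pol set" where
  "tree_map T f = sum_ideal T +>\<^bsub>param_ring T\<^esub> substitute (path_image T) f"

definition tree_ideal :: "('c, 'l) stree \<Rightarrow> (vertex, nat) pol set" where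
  "tree_ideal T = a_kernel (leaf_ring T) (param_ring T Quot sum_ideal T) (tree_map T)"

definition linear_forms :: "'x set \<Rightarrow> ('x, nat) pol set" where
  "linear_forms X = pol.span (var ` X)"

text \<open>
  \<open>B\<close> is the set of basis elements \<open>l\<^sub>1, \<dots>, l\<^sub>n\<close>. As these generate the polynomial ring,
  an algebra map on \<open>\<real>[l\<^sub>1, \<dots>, l\<^sub>n]\<close> is one on \<open>leaf_ring T\<close>.
\<close>

definition toric_structure :: "('c, 'l) stree \<Rightarrow> bool" where
  "toric_structure T \<longleftrightarrow>
     (\<exists>B (N::nat) (\<psi> :: (vertex, nat) pol \<Rightarrow> (nat, int) pol).
        pol.independent B \<and> pol.span B = linear_forms (leaves T) \<and>
        \<psi> \<in> alg_hom (leaf_ring T) (pol_ring {..<N}) \<and>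
        (\<forall>l\<in>B. \<exists>m. Poly_Mapping.keys m \<subseteq> {..<N} \<and> \<psi> l = monomial m) \<and>
        tree_ideal T = a_kernel (leaf_ring T) (pol_ring {..<N}) \<psi>)"

end

theory Submission
  imports Defs
begin

text \<open>
  Call an inner vertex of \<open>T\<close> lower if it is not an inner vertex of \<open>S\<close>. By the second
  hypothesis no stage contains both lower vertices and inner vertices of \<open>S\<close>, so the labels
  split into upper and lower ones, and two unrelated mechanisms take care of them.

  For the lower labels the third hypothesis yields a linear change of coordinates. Choose in
  every lower stage the label of the edge to the child \<open>v\<^sub>i\<close> with \<open>i = i\<^sub>c\<close>; these labels are
  the pivots. Every path that continues below \<open>v\<^sub>i\<close> can be copied below each sibling of \<open>v\<^sub>i\<close>.
  The sum of the images of all copies contains the factor \<open>\<theta>\<^sub>1 + \<dots> + \<theta>\<^sub>k\<close>, which is \<open>z\<close>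
  modulo the ideal \<open>\<langle>\<theta> - z\<rangle>\<close>. So for each leaf \<open>r\<close> there is a linear form (\<open>leaf_form\<close>) that
  the parametrisation sends to the monomial of \<open>r\<close> with all pivots replaced by \<open>z\<close>
  (\<open>image_pivot_form\<close>). These forms are a basis, because the form of \<open>r\<close> is \<open>p\<^sub>r\<close> plus
  variables of leaves whose paths have more labels that are not pivots
  (\<open>pivot_form_triangular\<close>).

  Let \<open>\<psi>\<close> send these basis elements to their monomials, in independent variables. The
  congruence just described shows that the kernel of \<open>\<psi>\<close> lies in the kernel of the
  parametrisation \<open>\<phi>\<close>. For the converse, let \<open>\<phi>(f) = 0\<close>. Then \<open>\<psi>(f)\<close>, as a polynomial in
  the parameters, vanishes at every point that satisfies the stage relations
  \<open>\<theta>\<^sub>1 + \<dots> + \<theta>\<^sub>k = z\<close>. It is enough that the monomials take no further values at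
  arbitrary positive points, for then \<open>\<psi>(f)\<close> vanishes at all positive points and is zero
  (\<open>toric_structure_if_points\<close>).

  So let \<open>y\<close> be a positive point (\<open>stochastic_point\<close>). The relation of a lower stage is
  satisfied by changing the value of its pivot, which does not occur in the monomials. For
  the upper stages one uses that \<open>S\<close> is balanced: the numbers \<open>\<theta>\<^sub>i t(v\<^sub>i) / t(v)\<close> sum to one at
  \<open>v\<close>, they depend on the stage of \<open>v\<close> only (\<open>weight_balanced\<close>), and along a path the
  factors \<open>t(v\<^sub>i) / t(v)\<close> telescope, so that passing to these numbers divides all path
  monomials by the same number \<open>t\<close> of the root (\<open>telescoping_path\<close>). Rescaling \<open>z\<close> and all
  labels by a common factor compensates for this division.
\<close>

section \<open>Evaluation of polynomials\<close>

abbreviation "keys \<equiv> Poly_Mapping.keys"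
abbreviation "lookup \<equiv> Poly_Mapping.lookup"
abbreviation "single \<equiv> Poly_Mapping.single"

definition mon_val :: "('x \<Rightarrow> 'b::comm_semiring_1) \<Rightarrow> ('x \<Rightarrow>\<^sub>0 nat) \<Rightarrow> 'b" where
  "mon_val g m = (\<Prod>x\<in>keys m. g x ^ lookup m x)"

lemma mon_val_superset:
  assumes "finite X" "keys m \<subseteq> X"
  shows "mon_val g m = (\<Prod>x\<in>X. g x ^ lookup m x)"
  unfolding mon_val_def
  by (rule prod.mono_neutral_left) (use assms in \<open>auto simp: in_keys_iff\<close>)

lemma mon_val_0 [simp]: "mon_val g 0 = 1"
  by (simp add: mon_val_def)

lemma mon_val_single [simp]: "mon_val g (single x n) = g x ^ n"
  by (simp add: mon_val_def)

lemma mon_val_add: "mon_val g (a + b) = mon_val g a * mon_val g b"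
proof -
  let ?X = "keys a \<union> keys b"
  have "mon_val g (a + b) = (\<Prod>x\<in>?X. g x ^ lookup (a + b) x)"
    by (rule mon_val_superset) (auto dest: subsetD[OF Poly_Mapping.keys_add])
  also have "\<dots> = (\<Prod>x\<in>?X. g x ^ lookup a x) * (\<Prod>x\<in>?X. g x ^ lookup b x)"
    by (simp add: lookup_add power_add prod.distrib)
  also have "\<dots> = mon_val g a * mon_val g b"
    by (simp add: mon_val_superset[of ?X])
  finally show ?thesis .
qed

text \<open>
  Substitution and evaluation at real points are instances of one construction, with the
  coefficients mapped along \<open>h\<close> to the constants of an arbitrary commutative ring.
\<close>

definition eval_pol ::
    "(real \<Rightarrow> 'b::comm_ring_1) \<Rightarrow> ('x \<Rightarrow> 'b) \<Rightarrow> ('x, nat) pol \<Rightarrow> 'b" where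
  "eval_pol h g f = (\<Sum>m\<in>keys f. h (lookup f m) * mon_val g m)"

lemma substitute_eq_eval_pol: "substitute g = eval_pol const g"
  by (rule ext) (simp add: substitute_def eval_pol_def mon_val_def)

lemma sum_single_keys: "(\<Sum>m\<in>keys f. single m (lookup f m)) = f"
  by (rule poly_mapping_eqI)
     (auto simp: lookup_sum lookup_single when_def in_keys_iff sum.delta')

lemma const_0 [simp]: "const 0 = 0"
  by (simp add: const_def)

lemma const_1 [simp]: "const 1 = 1"
  by (simp add: const_def)

lemma const_add: "const (a + b) = const a + const b"
  by (simp add: const_def single_add)

lemma const_mult: "const (a * b) = const a * const b"
  by (simp add: const_def mult_single)

lemma monomial_0 [simp]: "monomial 0 = 1"
  by (simp add: monomial_def)

lemma monomial_add: "monomial (a + b) = monomial a * monomial b"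
  by (simp add: monomial_def mult_single)

lemma monomial_sum: "monomial (\<Sum>x\<in>A. f x) = (\<Prod>x\<in>A. monomial (f x))"
  by (induction A rule: infinite_finite_induct) (simp_all add: monomial_add)

lemma single_eq_const_monomial: "single m c = const c * monomial m"
  by (simp add: const_def monomial_def mult_single)

lemma monomial_single_power:
  "monomial (single x (of_nat n :: 'e::comm_semiring_1)) = monomial (single x 1) ^ n"
proof (induction n)
  case (Suc n)
  then show ?case
    by (simp add: single_add monomial_add)
qed simp

locale coeff_hom =
  fixes h :: "real \<Rightarrow> 'b::comm_ring_1"
  assumes h_add: "h (a + b) = h a + h b"
    and h_mult: "h (a * b) = h a * h b"
    and h_1: "h 1 = 1"
begin

lemma h_0: "h 0 = 0"
  using h_add[of 0 0] by simp

lemma eval_superset: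
  assumes "finite K" "keys f \<subseteq> K"
  shows "eval_pol h g f = (\<Sum>m\<in>K. h (lookup f m) * mon_val g m)"
  unfolding eval_pol_def
  by (rule sum.mono_neutral_left) (use assms in \<open>auto simp: in_keys_iff h_0\<close>)

lemma eval_0 [simp]: "eval_pol h g 0 = 0"
  by (simp add: eval_pol_def)

lemma eval_add: "eval_pol h g (a + b) = eval_pol h g a + eval_pol h g b"
proof -
  let ?K = "keys a \<union> keys b"
  have "eval_pol h g (a + b) = (\<Sum>m\<in>?K. h (lookup (a + b) m) * mon_val g m)"
    by (rule eval_superset) (auto dest: subsetD[OF Poly_Mapping.keys_add])
  also have "\<dots> = (\<Sum>m\<in>?K. h (lookup a m) * mon_val g m) + (\<Sum>m\<in>?K. h (lookup b m) * mon_val g m)"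
    by (simp add: lookup_add h_add distrib_right sum.distrib)
  also have "\<dots> = eval_pol h g a + eval_pol h g b"
    by (simp add: eval_superset[of ?K])
  finally show ?thesis .
qed

lemma eval_sum: "eval_pol h g (\<Sum>i\<in>A. f i) = (\<Sum>i\<in>A. eval_pol h g (f i))"
  by (induction A rule: infinite_finite_induct) (simp_all add: eval_add)

lemma eval_single: "eval_pol h g (single m c) = h c * mon_val g m"
  by (simp add: eval_pol_def h_0)

lemma eval_const [simp]: "eval_pol h g (const c) = h c"
  by (simp add: const_def eval_single)

lemma eval_1 [simp]: "eval_pol h g 1 = 1"
  using eval_const[of g 1] by (simp add: h_1)

lemma eval_var [simp]: "eval_pol h g (var x) = g x"
  by (simp add: var_def monomial_def eval_single h_1)

lemma eval_mult: "eval_pol h g (a * b) = eval_pol h g a * eval_pol h g b"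
proof -
  have "a * b = (\<Sum>m\<in>keys a. \<Sum>n\<in>keys b. single (m + n) (lookup a m * lookup b n))"
    by (subst (1 2) sum_single_keys[symmetric])
       (simp add: sum_product mult_single)
  then have "eval_pol h g (a * b) =
      (\<Sum>m\<in>keys a. \<Sum>n\<in>keys b. (h (lookup a m) * mon_val g m) * (h (lookup b n) * mon_val g n))"
    by (simp add: eval_sum eval_single h_mult mon_val_add mult_ac)
  also have "\<dots> = eval_pol h g a * eval_pol h g b"
    by (simp add: eval_pol_def sum_product)
  finally show ?thesis .
qed

lemma eval_uminus: "eval_pol h g (- a) = - eval_pol h g a"
  using eval_add[of g a "- a"] by (simp add: eq_neg_iff_add_eq_0 add.commute)

lemma eval_diff: "eval_pol h g (a - b) = eval_pol h g a - eval_pol h g b"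
  using eval_add[of g a "- b"] by (simp add: eval_uminus)

lemma eval_power: "eval_pol h g (a ^ n) = eval_pol h g a ^ n"
  by (induction n) (simp_all add: eval_mult)

lemma eval_prod: "eval_pol h g (\<Prod>i\<in>A. f i) = (\<Prod>i\<in>A. eval_pol h g (f i))"
  by (induction A rule: infinite_finite_induct) (simp_all add: eval_mult)

lemma eval_prod_list: "eval_pol h g (prod_list fs) = prod_list (map (eval_pol h g) fs)"
  by (induction fs) (simp_all add: eval_mult)

lemma eval_sum_list: "eval_pol h g (sum_list fs) = sum_list (map (eval_pol h g) fs)"
  by (induction fs) (simp_all add: eval_add)

lemma eval_scale: "eval_pol h g (scale c f) = h c * eval_pol h g f"
  by (simp add: scale_def eval_mult)

lemma eval_mon_val: "eval_pol h g (mon_val k m) = mon_val (\<lambda>x. eval_pol h g (k x)) m"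
  by (simp add: mon_val_def eval_prod eval_power)

lemma eval_eval: "eval_pol h g (eval_pol const k f) = eval_pol h (\<lambda>x. eval_pol h g (k x)) f"
  by (simp add: eval_pol_def[of const] eval_sum eval_mult eval_mon_val)
     (simp add: eval_pol_def)

end

interpretation const: coeff_hom "const :: real \<Rightarrow> ('x, 'e::comm_monoid_add) pol"
  by unfold_locales (simp_all add: const_add const_mult)

interpretation real: coeff_hom "\<lambda>c::real. c"
  by unfold_locales simp_all

lemma mon_val_cong:
  "(\<And>x. x \<in> keys m \<Longrightarrow> g x = g' x) \<Longrightarrow> mon_val g m = mon_val g' m"
  by (simp add: mon_val_def)

lemma eval_pol_cong:
  assumes "f \<in> carrier (pol_ring X)" "\<And>x. x \<in> X \<Longrightarrow> g x = g' x"
  shows "eval_pol h g f = eval_pol h g' f"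
  unfolding eval_pol_def
proof (rule sum.cong[OF refl])
  fix m assume "m \<in> keys f"
  then have "mon_val g m = mon_val g' m"
    using assms by (intro mon_val_cong) (auto simp: pol_ring_def)
  then show "h (lookup f m) * mon_val g m = h (lookup f m) * mon_val g' m"
    by simp
qed

text \<open>
  The functions \<open>y \<mapsto> y\<^sup>m\<close> are distinct characters of a group of positive points, so this
  is Dedekind's independence argument: two monomials that differ at a variable \<open>x\<close> are
  separated by doubling the coordinate \<open>y x\<close>, which eliminates one of them from a relation.
\<close>

lemma monomials_independent:
  assumes "finite K"
    and "\<And>y :: 'x \<Rightarrow> real. (\<And>x. y x > 0) \<Longrightarrow> (\<Sum>m\<in>K. c m * mon_val y m) = 0"
    and "m \<in> K"
  shows "c m = 0"
  using assms
proof (induction K arbitrary: c m rule: finite_induct)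
  case (insert m1 K)
  have others: "c m2 = 0" if "m2 \<in> K" for m2
  proof -
    have "m2 \<noteq> m1"
      using insert.hyps that by auto
    then obtain x where x: "lookup m2 x \<noteq> lookup m1 x"
      by (meson poly_mapping_eqI)
    have "c m2 * (2 ^ lookup m2 x - 2 ^ lookup m1 x) = 0"
    proof (rule insert.IH[OF _ that])
      fix y :: "'x \<Rightarrow> real" assume y: "\<And>x. y x > 0"
      define y' where "y' = y(x := 2 * y x)"
      have y'_pos: "y' z > 0" for z
        using y by (simp add: y'_def)
      have y': "mon_val y' m = 2 ^ lookup m x * mon_val y m" for m
      proof -
        let ?X = "insert x (keys m)"
        have "mon_val y' m = (2 * y x) ^ lookup m x * (\<Prod>x\<in>?X - {x}. y' x ^ lookup m x)"
          using mon_val_superset[of ?X m y'] prod.remove[of ?X x "\<lambda>x. y' x ^ lookup m x"]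
          by (simp add: y'_def subset_insertI)
        also have "(\<Prod>x\<in>?X - {x}. y' x ^ lookup m x) = (\<Prod>x\<in>?X - {x}. y x ^ lookup m x)"
          by (rule prod.cong) (auto simp: y'_def)
        also have "(2 * y x) ^ lookup m x * \<dots> = 2 ^ lookup m x * (\<Prod>x\<in>?X. y x ^ lookup m x)"
          by (subst prod.remove[where x = x and A = ?X]) (auto simp: power_mult_distrib)
        also have "(\<Prod>x\<in>?X. y x ^ lookup m x) = mon_val y m"
          by (rule mon_val_superset[symmetric]) auto
        finally show ?thesis .
      qed
      have "0 = (\<Sum>m\<in>insert m1 K. c m * mon_val y' m) - 2 ^ lookup m1 x * (\<Sum>m\<in>insert m1 K. c m * mon_val y m)"
        using insert.prems(1)[OF y] insert.prems(1)[of y', OF y'_pos] by simp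
      also have "\<dots> = (\<Sum>m\<in>insert m1 K. c m * (2 ^ lookup m x - 2 ^ lookup m1 x) * mon_val y m)"
        unfolding sum_distrib_left sum_subtractf[symmetric]
        by (rule sum.cong) (simp_all add: y' algebra_simps)
      also have "\<dots> = (\<Sum>m\<in>K. c m * (2 ^ lookup m x - 2 ^ lookup m1 x) * mon_val y m)"
        using insert.hyps by simp
      finally show "(\<Sum>m\<in>K. c m * (2 ^ lookup m x - 2 ^ lookup m1 x) * mon_val y m) = 0"
        by simp
    qed
    then show ?thesis
      using x by simp
  qed
  have "c m1 = 0"
    using insert.prems(1)[of "\<lambda>_. 1"] insert.hyps others by (simp add: mon_val_def)
  then show ?case
    using insert.prems(2) others by auto
qed simp

lemma eval_pos_imp_0:
  assumes "\<And>y :: 'x \<Rightarrow> real. (\<And>x. y x > 0) \<Longrightarrow> eval_pol (\<lambda>c. c) y f = 0"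
  shows "f = 0"
proof (rule poly_mapping_eqI)
  fix m
  have "lookup f m = 0" if "m \<in> keys f"
  proof (rule monomials_independent[of "keys f" "lookup f"])
    show "(\<Sum>m\<in>keys f. lookup f m * mon_val y m) = 0" if "\<And>x. y x > 0" for y
      using assms[OF that] by (simp only: eval_pol_def)
    show "m \<in> keys f"
      by (rule that)
  qed (rule finite_keys)
  then show "lookup f m = lookup 0 m"
    by (auto simp: in_keys_iff)
qed

section \<open>Rings of polynomials in a set of variables\<close>

lemma pol_ring_simps [simp]:
  "mult (pol_ring X) = (*)" "one (pol_ring X) = 1"
  "zero (pol_ring X) = 0" "add (pol_ring X) = (+)"
  by (simp_all add: pol_ring_def)

lemma carrier_pol_ring_iff:
  "f \<in> carrier (pol_ring X) \<longleftrightarrow> (\<forall>m\<in>keys f. keys m \<subseteq> X)"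
  by (simp add: pol_ring_def)

lemma pol_ring_0 [simp]: "0 \<in> carrier (pol_ring X)"
  by (simp add: carrier_pol_ring_iff)

lemma pol_ring_const [simp]: "const c \<in> carrier (pol_ring X)"
  by (simp add: carrier_pol_ring_iff const_def)

lemma pol_ring_1 [simp]: "1 \<in> carrier (pol_ring X)"
  using pol_ring_const[of 1] by simp

lemma pol_ring_monomial_iff [simp]: "monomial m \<in> carrier (pol_ring X) \<longleftrightarrow> keys m \<subseteq> X"
  by (simp add: carrier_pol_ring_iff monomial_def)

lemma pol_ring_var_iff [simp]: "var x \<in> carrier (pol_ring X) \<longleftrightarrow> x \<in> X"
  by (simp add: var_def)

lemma pol_ring_add [intro]:
  "a \<in> carrier (pol_ring X) \<Longrightarrow> b \<in> carrier (pol_ring X) \<Longrightarrow> a + b \<in> carrier (pol_ring X)"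
  using Poly_Mapping.keys_add[of a b] by (fastforce simp: carrier_pol_ring_iff)

lemma pol_ring_mult [intro]:
  assumes "a \<in> carrier (pol_ring X)" "b \<in> carrier (pol_ring X)"
  shows "a * b \<in> carrier (pol_ring X)"
  unfolding carrier_pol_ring_iff
proof
  fix m assume "m \<in> keys (a * b)"
  then obtain m1 m2 where "m = m1 + m2" "m1 \<in> keys a" "m2 \<in> keys b"
    using keys_mult[of a b] by blast
  then show "keys m \<subseteq> X"
    using assms Poly_Mapping.keys_add[of m1 m2] by (fastforce simp: carrier_pol_ring_iff)
qed

lemma pol_ring_uminus [intro]: "a \<in> carrier (pol_ring X) \<Longrightarrow> - a \<in> carrier (pol_ring X)"
  by (simp add: carrier_pol_ring_iff in_keys_iff)

lemma pol_ring_diff [intro]: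
  "a \<in> carrier (pol_ring X) \<Longrightarrow> b \<in> carrier (pol_ring X) \<Longrightarrow> a - b \<in> carrier (pol_ring X)"
  using pol_ring_add[of a X "- b"] pol_ring_uminus by auto

lemma pol_ring_sum [intro]:
  "(\<And>i. i \<in> A \<Longrightarrow> f i \<in> carrier (pol_ring X)) \<Longrightarrow> (\<Sum>i\<in>A. f i) \<in> carrier (pol_ring X)"
  by (induction A rule: infinite_finite_induct) auto

lemma pol_ring_power [intro]:
  "a \<in> carrier (pol_ring X) \<Longrightarrow> a ^ n \<in> carrier (pol_ring X)"
  by (induction n) auto

lemma pol_ring_prod [intro]:
  "(\<And>i. i \<in> A \<Longrightarrow> f i \<in> carrier (pol_ring X)) \<Longrightarrow> (\<Prod>i\<in>A. f i) \<in> carrier (pol_ring X)"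
  by (induction A rule: infinite_finite_induct) auto

lemma pol_ring_prod_list [intro]:
  "(\<And>a. a \<in> set fs \<Longrightarrow> a \<in> carrier (pol_ring X)) \<Longrightarrow> prod_list fs \<in> carrier (pol_ring X)"
  by (induction fs) auto

lemma pol_ring_sum_list [intro]:
  "(\<And>a. a \<in> set fs \<Longrightarrow> a \<in> carrier (pol_ring X)) \<Longrightarrow> sum_list fs \<in> carrier (pol_ring X)"
  by (induction fs) auto

lemma pol_ring_eval [intro]:
  assumes "f \<in> carrier (pol_ring X)" "\<And>x. x \<in> X \<Longrightarrow> g x \<in> carrier (pol_ring Y)"
  shows "eval_pol const g f \<in> carrier (pol_ring Y)"
  unfolding eval_pol_def mon_val_def
  using assms by (intro pol_ring_sum pol_ring_mult pol_ring_prod pol_ring_power pol_ring_const)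
    (auto simp: carrier_pol_ring_iff[of f])

lemma cring_pol_ring: "cring (pol_ring X)"
proof (intro cringI abelian_groupI comm_monoidI)
  fix x assume "x \<in> carrier (pol_ring X)"
  then have "- x \<in> carrier (pol_ring X)" "- x + x = 0"
    by auto
  then show "\<exists>y\<in>carrier (pol_ring X). y \<oplus>\<^bsub>pol_ring X\<^esub> x = \<zero>\<^bsub>pol_ring X\<^esub>"
    by (metis pol_ring_simps(3,4))
qed (auto simp: algebra_simps)

section \<open>Congruence modulo an ideal\<close>

locale pol_ideal = ideal I "pol_ring X" for I :: "('x, 'e::comm_monoid_add) pol set" and X
begin

definition cong :: "('x, 'e) pol \<Rightarrow> ('x, 'e) pol \<Rightarrow> bool" where
  "cong f g \<longleftrightarrow> f \<in> carrier (pol_ring X) \<and> g \<in> carrier (pol_ring X) \<and> f - g \<in> I"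

lemma ideal_0: "0 \<in> I"
  using additive_subgroup.zero_closed[OF is_additive_subgroup] by simp

lemma ideal_add: "f \<in> I \<Longrightarrow> g \<in> I \<Longrightarrow> f + g \<in> I"
  using additive_subgroup.a_closed[OF is_additive_subgroup, of f g] by simp

lemma ideal_mult: "f \<in> I \<Longrightarrow> g \<in> carrier (pol_ring X) \<Longrightarrow> g * f \<in> I"
  using I_l_closed[of f g] by simp

lemma ideal_uminus: "f \<in> I \<Longrightarrow> - f \<in> I"
  using ideal_mult[of f "const (-1)", OF _ pol_ring_const] by (simp add: const_def single_uminus)

lemma ideal_diff: "f \<in> I \<Longrightarrow> g \<in> I \<Longrightarrow> f - g \<in> I"
  using ideal_add[of f "- g"] ideal_uminus[of g] by simp

lemma cong_refl: "f \<in> carrier (pol_ring X) \<Longrightarrow> cong f f"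
  by (simp add: cong_def ideal_0)

lemma cong_trans [trans]: "cong f g \<Longrightarrow> cong g h \<Longrightarrow> cong f h"
  using ideal_add[of "f - g" "g - h"] by (simp add: cong_def)

lemma cong_add: "cong f g \<Longrightarrow> cong f' g' \<Longrightarrow> cong (f + f') (g + g')"
  using ideal_add[of "f - g" "f' - g'"] by (auto simp: cong_def algebra_simps)

lemma cong_mult:
  assumes "cong f g" "cong f' g'"
  shows "cong (f * f') (g * g')"
proof -
  have "f' * (f - g) + g * (f' - g') \<in> I"
    using assms by (intro ideal_add ideal_mult) (auto simp: cong_def)
  also have "f' * (f - g) + g * (f' - g') = f * f' - g * g'"
    by (simp add: algebra_simps)
  finally show ?thesis
    using assms by (auto simp: cong_def)
qed

lemma cong_power: "cong f g \<Longrightarrow> cong (f ^ n) (g ^ n)"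
  by (induction n) (auto intro: cong_mult cong_refl)

lemma cong_sum: "(\<And>i. i \<in> A \<Longrightarrow> cong (f i) (g i)) \<Longrightarrow> cong (\<Sum>i\<in>A. f i) (\<Sum>i\<in>A. g i)"
  by (induction A rule: infinite_finite_induct) (auto intro: cong_add cong_refl)

lemma cong_prod: "(\<And>i. i \<in> A \<Longrightarrow> cong (f i) (g i)) \<Longrightarrow> cong (\<Prod>i\<in>A. f i) (\<Prod>i\<in>A. g i)"
  by (induction A rule: infinite_finite_induct) (auto intro: cong_mult cong_refl)

lemma cong_scale: "cong f g \<Longrightarrow> cong (scale c f) (scale c g)"
  unfolding scale_def by (intro cong_mult cong_refl pol_ring_const)

lemma cong_eval:
  assumes "f \<in> carrier (pol_ring Y)" "\<And>y. y \<in> Y \<Longrightarrow> cong (g y) (g' y)"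
  shows "cong (eval_pol const g f) (eval_pol const g' f)"
  unfolding eval_pol_def mon_val_def
  using assms by (intro cong_sum cong_mult cong_prod cong_power cong_refl pol_ring_const)
    (auto simp: carrier_pol_ring_iff[of f])

lemma cong_ideal_iff: "cong f g \<Longrightarrow> f \<in> I \<longleftrightarrow> g \<in> I"
  using ideal_diff[of f "f - g"] ideal_add[of "f - g" g] by (auto simp: cong_def)

lemma coset_eq_ideal_iff:
  "f \<in> carrier (pol_ring X) \<Longrightarrow> I +>\<^bsub>pol_ring X\<^esub> f = I \<longleftrightarrow> f \<in> I"
  using a_rcos_self[of f] a_rcos_const[of f] by auto

end

text \<open>
  Evaluation at a point that satisfies all stage relations therefore factors through the
  quotient by the ideal that they generate.
\<close>

lemma ideal_vanishing:
  "ideal {f \<in> carrier (pol_ring X). eval_pol (\<lambda>c. c) y f = 0} (pol_ring X)"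
    (is "ideal ?V _")
proof -
  interpret R: cring "pol_ring X :: ('a, nat) pol ring"
    by (rule cring_pol_ring)
  show ?thesis
  proof (rule idealI[OF R.ring_axioms])
    show "subgroup ?V (add_monoid (pol_ring X))"
    proof (rule R.add.subgroupI)
      fix f assume f: "f \<in> ?V"
      have "\<ominus>\<^bsub>pol_ring X\<^esub> f = - f"
        using f by (intro R.minus_equality) auto
      then show "\<ominus>\<^bsub>pol_ring X\<^esub> f \<in> ?V"
        using f by (auto simp: real.eval_uminus)
    next
      have "0 \<in> ?V"
        by simp
      then show "?V \<noteq> {}"
        by blast
    qed (auto simp: real.eval_add)
  qed (auto simp: real.eval_mult)
qed

section \<open>Vertices of trees\<close>

lemma subtree_at_Leaf [simp]: "subtree_at Leaf v = Leaf"
  by (cases v) auto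

lemma path_labels_Nil [simp]: "path_labels T [] = []"
  by (cases T) auto

lemma subtree_at_append: "subtree_at T (v @ w) = subtree_at (subtree_at T v) w"
  by (induction T v rule: is_vertex.induct) auto

lemma is_vertex_append: "is_vertex T (v @ w) \<longleftrightarrow> is_vertex T v \<and> is_vertex (subtree_at T v) w"
  by (induction T v rule: is_vertex.induct) auto

lemma path_labels_append:
  "is_vertex T v \<Longrightarrow> path_labels T (v @ w) = path_labels T v @ path_labels (subtree_at T v) w"
  by (induction T v rule: is_vertex.induct) auto

lemma length_path_labels: "v \<in> vertices T \<Longrightarrow> length (path_labels T v) = length v"
  unfolding vertices_def mem_Collect_eq by (induction T v rule: is_vertex.induct) auto

lemma Nil_in_vertices [simp]: "[] \<in> vertices T"
  by (simp add: vertices_def)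

lemma vertices_append_iff:
  "v @ w \<in> vertices T \<longleftrightarrow> v \<in> vertices T \<and> w \<in> vertices (subtree_at T v)"
  by (simp add: vertices_def is_vertex_append)

lemma vertices_child_iff: "v @ [i] \<in> vertices T \<longleftrightarrow> v \<in> vertices T \<and> i < num_children T v"
  by (cases "subtree_at T v")
     (auto simp: vertices_append_iff num_children_def out_labels_def, auto simp: vertices_def)

lemma path_labels_child:
  assumes "v @ [i] \<in> vertices T"
  shows "path_labels T (v @ [i]) = path_labels T v @ [out_labels T v ! i]"
  using assms
  by (cases "subtree_at T v")
     (auto simp: vertices_def is_vertex_append path_labels_append out_labels_def)

lemma inner_if_num_children: "v \<in> vertices T \<Longrightarrow> 0 < num_children T v \<Longrightarrow> v \<in> inner_vertices T"
  by (auto simp: inner_vertices_def num_children_def out_labels_def)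

lemma inner_if_child: "v @ [i] \<in> vertices T \<Longrightarrow> v \<in> inner_vertices T"
  using inner_if_num_children[of v T] by (auto simp: vertices_child_iff)

lemma inner_if_extends:
  assumes "v @ i # w \<in> vertices T"
  shows "v \<in> inner_vertices T" "v @ [i] \<in> vertices T" "i < num_children T v"
proof -
  show "v @ [i] \<in> vertices T"
    using assms vertices_append_iff[of "v @ [i]" w T] by simp
  then show "v \<in> inner_vertices T" "i < num_children T v"
    by (auto simp: vertices_child_iff intro: inner_if_child)
qed

lemma vertices_Node:
  "vertices (Node c ts) = insert [] (\<Union>i<length ts. (#) i ` vertices (snd (ts ! i)))"
proof (rule Set.set_eqI)
  fix v show "v \<in> vertices (Node c ts) \<longleftrightarrow> v \<in> insert [] (\<Union>i<length ts. (#) i ` vertices (snd (ts ! i)))"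
    by (cases v) (auto simp: vertices_def)
qed

lemma finite_vertices [simp]: "finite (vertices T)"
proof (induction T)
  case Leaf
  have "v = []" if "v \<in> vertices Leaf" for v
    using that by (cases v) (auto simp: vertices_def)
  then show ?case
    by (intro finite_subset[of "vertices Leaf" "{[]}"]) auto
next
  case (Node c ts)
  have "finite (vertices (snd (ts ! i)))" if "i < length ts" for i
    using Node[of "ts ! i" "snd (ts ! i)"] that by (metis nth_mem prod_set_simps(2) prod.collapse singletonI)
  then show ?case
    by (auto simp: vertices_Node)
qed

lemma finite_leaves [simp]: "finite (leaves T)"
  by (simp add: leaves_def)

lemma finite_inner_vertices [simp]: "finite (inner_vertices T)"
  by (simp add: inner_vertices_def)

lemma vertices_cases:
  assumes "v \<in> vertices T"
  obtains "v \<in> leaves T" | "v \<in> inner_vertices T"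
  using assms by (auto simp: leaves_def inner_vertices_def)

lemma leaf_num_children: "v \<in> leaves T \<Longrightarrow> num_children T v = 0"
  by (simp add: leaves_def num_children_def out_labels_def)

lemma leaf_append_iff: "v \<in> leaves T \<Longrightarrow> v @ w \<in> vertices T \<longleftrightarrow> w = []"
  using inner_if_extends(3)[of v "hd w" "tl w" T] leaf_num_children[of v T]
  by (cases w) (auto simp: leaves_def)

lemma length_leaf_le_depth: "r \<in> leaves T \<Longrightarrow> length r \<le> depth T"
  unfolding depth_def by (rule Max_ge) auto

text \<open>
  This is what identifies a path below the pivot child with its copies below the siblings.
\<close>

lemma rooted_subtree_path_labels:
  assumes "rooted_subtree A B" "v \<in> vertices A"
  shows "path_labels A v = path_labels B v"
  using assms(2)
proof (induction v rule: rev_induct)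
  case (snoc i v)
  then have "v \<in> vertices A" "v \<in> inner_vertices A"
    by (auto simp: vertices_child_iff inner_if_child)
  moreover have "v @ [i] \<in> vertices B"
    using snoc.prems assms(1) by (auto simp: rooted_subtree_def)
  ultimately show ?case
    using snoc assms(1) by (simp add: path_labels_child rooted_subtree_def)
qed simp

definition leaves_below :: "('c, 'l) stree \<Rightarrow> vertex \<Rightarrow> vertex set" where
  "leaves_below T v = {r \<in> leaves T. \<exists>w. r = v @ w}"

lemma finite_leaves_below [simp]: "finite (leaves_below T v)"
  by (simp add: leaves_below_def)

lemma leaves_below_leaf: "r \<in> leaves T \<Longrightarrow> leaves_below T r = {r}"
proof (intro equalityI subsetI)
  fix s assume "s \<in> leaves_below T r" and r: "r \<in> leaves T"
  then obtain w where "s = r @ w" "r @ w \<in> vertices T"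
    by (auto simp: leaves_below_def leaves_def)
  then show "s \<in> {r}"
    using leaf_append_iff[OF r, of w] by simp
qed (auto simp: leaves_below_def)

lemma leaves_below_inner:
  assumes "v \<in> inner_vertices T"
  shows "leaves_below T v = (\<Union>i<num_children T v. leaves_below T (v @ [i]))"
proof (intro equalityI subsetI)
  fix r assume "r \<in> leaves_below T v"
  then obtain w where r: "r = v @ w" "r \<in> leaves T"
    by (auto simp: leaves_below_def)
  obtain i w' where w: "w = i # w'"
    using r assms by (cases w) (auto simp: leaves_def inner_vertices_def)
  then have "i < num_children T v"
    using r inner_if_extends(3)[of v i w' T] by (simp add: leaves_def)
  then show "r \<in> (\<Union>i<num_children T v. leaves_below T (v @ [i]))"
    using r w by (auto simp: leaves_below_def)
qed (auto simp: leaves_below_def)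

lemma sum_leaves_below_inner:
  assumes "v \<in> inner_vertices T"
  shows "(\<Sum>r\<in>leaves_below T v. f r) = (\<Sum>i<num_children T v. \<Sum>r\<in>leaves_below T (v @ [i]). f r)"
  unfolding leaves_below_inner[OF assms]
  by (rule sum.UNION_disjoint) (auto simp: leaves_below_def)

lemma staged_tree_inner:
  assumes "staged_tree T" "v \<in> inner_vertices T"
  shows "distinct (out_labels T v)" "2 \<le> num_children T v"
  using assms unfolding staged_tree_def by blast+

lemma staged_tree_disjoint_or_equal:
  assumes "staged_tree T" "u \<in> inner_vertices T" "v \<in> inner_vertices T"
  shows "out_labels T u = out_labels T v \<or> set (out_labels T u) \<inter> set (out_labels T v) = {}"
  using assms unfolding staged_tree_def by blast

text \<open>
  In a staged tree an inner vertex has children, so a longest extension of a vertex ends in a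
  leaf. Hence vertices, and not only leaves, have length at most \<open>depth T\<close>, so that
  the truncated differences in the exponents of \<open>z\<close> are true differences.
\<close>

lemma leaves_below_nonempty:
  assumes "staged_tree T" "v \<in> vertices T"
  shows "leaves_below T v \<noteq> {}"
  using assms(2)
proof (induction "Max (length ` vertices T) - length v" arbitrary: v rule: less_induct)
  case less
  show ?case
    using \<open>v \<in> vertices T\<close>
  proof (cases rule: vertices_cases)
    case 1
    then show ?thesis
      by (simp add: leaves_below_leaf)
  next
    case 2
    then have v0: "v @ [0] \<in> vertices T"
      using staged_tree_inner(2)[OF assms(1)] less.prems by (fastforce simp: vertices_child_iff)
    then have "length (v @ [0]) \<le> Max (length ` vertices T)"
      by (intro Max_ge finite_imageI imageI) simp_all
    then have "leaves_below T (v @ [0]) \<noteq> {}"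
      using v0 by (intro less.hyps) auto
    then show ?thesis
      by (auto simp: leaves_below_def)
  qed
qed

lemma length_vertex_le_depth:
  assumes "staged_tree T" "v \<in> vertices T"
  shows "length v \<le> depth T"
proof -
  obtain w where "v @ w \<in> leaves T"
    using leaves_below_nonempty[OF assms] by (auto simp: leaves_below_def)
  from length_leaf_le_depth[OF this] show ?thesis
    by simp
qed

section \<open>Straightening the linear relations\<close>

text \<open>
  A set of pivots selects at most one label at each inner vertex, and the tree below the
  pivot child embeds below all its siblings. Vertices without a pivot are left alone by the
  change of coordinates; later these are the inner vertices of \<open>S\<close>.
\<close>

locale pivoted_tree =
  fixes T :: "('c, 'l) stree" and Piv :: "'l set"
  assumes staged: "staged_tree T"
    and pivot_unique: "\<And>v i j. v \<in> inner_vertices T \<Longrightarrow> i < num_children T v \<Longrightarrow>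
      j < num_children T v \<Longrightarrow> out_labels T v ! i \<in> Piv \<Longrightarrow> out_labels T v ! j \<in> Piv \<Longrightarrow> i = j"
    and pivot_subtree: "\<And>v i j. v \<in> inner_vertices T \<Longrightarrow> i < num_children T v \<Longrightarrow>
      j < num_children T v \<Longrightarrow> out_labels T v ! i \<in> Piv \<Longrightarrow>
      rooted_subtree (subtree_at T (v @ [i])) (subtree_at T (v @ [j]))"
begin

definition params :: "'l param set" where
  "params = insert Z (Lab ` label_set T)"

lemma param_ring_eq: "param_ring T = pol_ring params"
  by (simp add: param_ring_def params_def)

lemma finite_params: "finite params"
  by (simp add: params_def label_set_def)

definition pvar :: "'l \<Rightarrow> 'l param" where
  "pvar l = (if l \<in> Piv then Z else Lab l)"

text \<open>
  The path monomial of the vertex \<open>v @ w\<close>, homogenised to degree \<open>depth T\<close>, where the pivots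
  are replaced by \<open>z\<close> only on the part \<open>w\<close> of the path.
\<close>

definition pivot_monomial :: "vertex \<Rightarrow> vertex \<Rightarrow> ('l param, nat) pol" where
  "pivot_monomial v w = var Z ^ (depth T - length v - length w) *
     prod_list (map (\<lambda>l. var (Lab l)) (path_labels T v)) *
     prod_list (map (\<lambda>l. var (pvar l)) (path_labels (subtree_at T v) w))"

definition below :: "vertex \<Rightarrow> (vertex, nat) pol" where
  "below v = (\<Sum>r\<in>leaves_below T v. var r)"

text \<open>
  The sum of \<open>below u\<close> over all copies \<open>u\<close> of the path \<open>v @ w\<close> that arise by replacing steps of
  \<open>w\<close> along pivots by steps to arbitrary siblings. A copy may end in an inner vertex of \<open>T\<close> even
  if \<open>v @ w\<close> is a leaf, which is why the variables of all leaves below it are added up.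
\<close>

primrec pivot_form :: "vertex \<Rightarrow> vertex \<Rightarrow> (vertex, nat) pol" where
  "pivot_form [] v = below v"
| "pivot_form (i # w) v =
     (if out_labels T v ! i \<in> Piv
      then \<Sum>j<num_children T v. pivot_form w (v @ [j])
      else pivot_form w (v @ [i]))"

text \<open>
  The quantity that grows when a pivot step is replaced; it makes the change of coordinates
  triangular.
\<close>

definition num_free :: "vertex \<Rightarrow> nat" where
  "num_free v = length (filter (\<lambda>l. l \<notin> Piv) (path_labels T v))"

lemma out_label_in_label_set:
  "v \<in> inner_vertices T \<Longrightarrow> i < num_children T v \<Longrightarrow> out_labels T v ! i \<in> label_set T"
  unfolding label_set_def num_children_def by (intro UN_I[of v] nth_mem)

lemma path_labels_subset: "v \<in> vertices T \<Longrightarrow> set (path_labels T v) \<subseteq> label_set T"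
proof (induction v rule: rev_induct)
  case (snoc i v)
  then have "out_labels T v ! i \<in> label_set T" "v \<in> vertices T"
    using out_label_in_label_set[of v i] inner_if_child[of v i T]
    by (simp_all add: vertices_child_iff)
  then show ?case
    using snoc by (simp add: path_labels_child)
qed simp

lemma var_Z_in [simp]: "Z \<in> params"
  by (simp add: params_def)

lemma Lab_in_params_iff [simp]: "Lab l \<in> params \<longleftrightarrow> l \<in> label_set T"
  by (auto simp: params_def)

lemma pvar_in_params: "l \<in> label_set T \<Longrightarrow> pvar l \<in> params"
  by (simp add: pvar_def)

lemma path_labels_subtree_subset:
  assumes "v @ w \<in> vertices T"
  shows "set (path_labels (subtree_at T v) w) \<subseteq> label_set T"
  using assms path_labels_subset[of "v @ w"]
  by (auto simp: vertices_def is_vertex_append path_labels_append)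

lemma path_image_carrier: "v \<in> vertices T \<Longrightarrow> path_image T v \<in> carrier (pol_ring params)"
  unfolding path_image_def using path_labels_subset[of v]
  by (intro pol_ring_mult pol_ring_power pol_ring_prod_list) auto

lemma stage_relations_carrier:
  "{(\<Sum>l\<leftarrow>out_labels T v. var (Lab l)) - var Z | v. v \<in> inner_vertices T}
     \<subseteq> carrier (pol_ring params)"
  by (force simp: label_set_def)

lemma sum_ideal_ideal: "ideal (sum_ideal T) (pol_ring params)"
  unfolding sum_ideal_def param_ring_eq
  by (rule ring.genideal_ideal[OF cring.axioms(1)[OF cring_pol_ring] stage_relations_carrier])

sublocale pol_ideal "sum_ideal T" params
  by (rule pol_ideal.intro) (rule sum_ideal_ideal)

lemma stage_relation:
  assumes "v \<in> inner_vertices T"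
  shows "cong (\<Sum>i<num_children T v. var (Lab (out_labels T v ! i))) (var Z)"
proof -
  have "(\<Sum>l\<leftarrow>out_labels T v. var (Lab l)) - var Z \<in> sum_ideal T"
    unfolding sum_ideal_def param_ring_eq
    using ring.genideal_self[OF cring.axioms(1)[OF cring_pol_ring] stage_relations_carrier] assms
    by blast
  moreover have "(\<Sum>l\<leftarrow>out_labels T v. var (Lab l)) =
      (\<Sum>i<num_children T v. var (Lab (out_labels T v ! i)))"
    by (simp add: sum_list_sum_nth num_children_def atLeast0LessThan)
  ultimately show ?thesis
    using out_label_in_label_set[OF assms] unfolding cong_def
    by (auto intro!: pol_ring_sum)
qed

lemma stage_relation_mult:
  assumes "v \<in> inner_vertices T" "a \<in> carrier (pol_ring params)"
  shows "cong (\<Sum>i<num_children T v. a * var (Lab (out_labels T v ! i))) (a * var Z)"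
  unfolding sum_distrib_left[symmetric]
  using assms by (intro cong_mult cong_refl stage_relation)

abbreviation param_image :: "(vertex, nat) pol \<Rightarrow> ('l param, nat) pol" where
  "param_image \<equiv> eval_pol const (path_image T)"

text \<open>
  The probabilities of all paths through \<open>v\<close> add up to the probability of reaching \<open>v\<close>: each
  inner vertex below \<open>v\<close> contributes one stage relation, from the leaves upwards.
\<close>

lemma image_below:
  assumes "v \<in> vertices T"
  shows "cong (param_image (below v)) (path_image T v)"
  using assms
proof (induction "depth T - length v" arbitrary: v rule: less_induct)
  case less
  show ?case
    using \<open>v \<in> vertices T\<close>
  proof (cases rule: vertices_cases)
    case 1
    then show ?thesis
      using less.prems by (simp add: below_def leaves_below_leaf cong_refl path_image_carrier)
  next
    case 2
    define a where "a = var Z ^ (depth T - length v - 1) *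
      prod_list (map (\<lambda>l. var (Lab l)) (path_labels T v))"
    have a: "a \<in> carrier (pol_ring params)"
      unfolding a_def using path_labels_subset[OF less.prems]
      by (intro pol_ring_mult pol_ring_power pol_ring_prod_list) auto
    have child: "v @ [i] \<in> vertices T" if "i < num_children T v" for i
      using that less.prems by (simp add: vertices_child_iff)
    have "num_children T v \<noteq> 0"
      using staged_tree_inner(2)[OF staged 2] by simp
    then have depth: "length v < depth T"
      using length_vertex_le_depth[OF staged child[of 0]] by simp
    have "param_image (below v) = (\<Sum>i<num_children T v. param_image (below (v @ [i])))"
      by (simp add: below_def const.eval_sum sum_leaves_below_inner[OF 2])
    also have "cong \<dots> (\<Sum>i<num_children T v. path_image T (v @ [i]))"
      using depth child by (intro cong_sum less.hyps) auto
    also have "(\<Sum>i<num_children T v. path_image T (v @ [i])) =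
        (\<Sum>i<num_children T v. a * var (Lab (out_labels T v ! i)))"
      using child by (intro sum.cong) (auto simp: path_image_def path_labels_child a_def mult.assoc)
    also have "cong \<dots> (a * var Z)"
      by (rule stage_relation_mult[OF 2 a])
    also have "a * var Z = path_image T v"
    proof -
      have "(var Z :: ('l param, nat) pol) ^ (depth T - length v) = var Z ^ (depth T - length v - 1) * var Z"
        using depth by (simp add: Suc_diff_Suc flip: power_Suc2)
      then show ?thesis
        unfolding a_def path_image_def by (simp only: mult_ac)
    qed
    finally show ?thesis .
  qed
qed

text \<open>
  At a pivot step the path below \<open>v\<close> is copied to all children, with the same labels
  afterwards, so the sum over the children is a multiple of a stage relation and the pivot
  turns into \<open>z\<close>.
\<close>

lemma image_pivot_form:
  "v @ w \<in> vertices T \<Longrightarrow> cong (param_image (pivot_form w v)) (pivot_monomial v w)"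
proof (induction w arbitrary: v)
  case Nil
  then show ?case
    using image_below[of v] by (simp add: pivot_monomial_def path_image_def[of T v])
next
  case (Cons i w)
  note v = inner_if_extends[OF Cons.prems]
  have depth: "length v + length w < depth T"
    using length_vertex_le_depth[OF staged Cons.prems] by simp
  have labels: "path_labels (subtree_at T v) (i # w) =
      out_labels T v ! i # path_labels (subtree_at T (v @ [i])) w"
    using v by (cases "subtree_at T v")
      (auto simp: inner_vertices_def out_labels_def num_children_def subtree_at_append)
  show ?case
  proof (cases "out_labels T v ! i \<in> Piv")
    case True
    define a where "a = var Z ^ (depth T - length v - length (i # w)) *
      prod_list (map (\<lambda>l. var (Lab l)) (path_labels T v)) *
      prod_list (map (\<lambda>l. var (pvar l)) (path_labels (subtree_at T (v @ [i])) w))"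
    have a: "a \<in> carrier (pol_ring params)"
      unfolding a_def
      using path_labels_subset[of v] path_labels_subtree_subset[of "v @ [i]" w] Cons.prems v
      by (intro pol_ring_mult pol_ring_power pol_ring_prod_list)
         (auto simp: inner_vertices_def intro!: pvar_in_params)
    \<comment> \<open>The remaining path can be copied below each sibling of the pivot child.\<close>
    have child: "(v @ [j]) @ w \<in> vertices T"
        "path_labels (subtree_at T (v @ [j])) w = path_labels (subtree_at T (v @ [i])) w"
      if "j < num_children T v" for j
    proof -
      have sub: "rooted_subtree (subtree_at T (v @ [i])) (subtree_at T (v @ [j]))"
        using pivot_subtree v that True by blast
      have w: "w \<in> vertices (subtree_at T (v @ [i]))"
        using Cons.prems vertices_append_iff[of "v @ [i]" w T] by simp
      then have "w \<in> vertices (subtree_at T (v @ [j]))"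
        using sub by (auto simp: rooted_subtree_def)
      moreover have "v @ [j] \<in> vertices T"
        using v that by (simp add: vertices_child_iff inner_vertices_def)
      ultimately show "(v @ [j]) @ w \<in> vertices T"
        by (simp only: vertices_append_iff)
      show "path_labels (subtree_at T (v @ [j])) w = path_labels (subtree_at T (v @ [i])) w"
        using rooted_subtree_path_labels[OF sub w] by simp
    qed
    have "param_image (pivot_form (i # w) v) = (\<Sum>j<num_children T v. param_image (pivot_form w (v @ [j])))"
      using True by (simp add: const.eval_sum)
    also have "cong \<dots> (\<Sum>j<num_children T v. pivot_monomial (v @ [j]) w)"
      by (intro cong_sum Cons.IH child) simp
    also have "(\<Sum>j<num_children T v. pivot_monomial (v @ [j]) w) =
        (\<Sum>j<num_children T v. a * var (Lab (out_labels T v ! j)))"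
    proof (rule sum.cong[OF refl])
      fix j assume "j \<in> {..<num_children T v}"
      then have j: "j < num_children T v" "v @ [j] \<in> vertices T"
        using v by (simp_all add: vertices_child_iff inner_vertices_def)
      show "pivot_monomial (v @ [j]) w = a * var (Lab (out_labels T v ! j))"
        unfolding pivot_monomial_def a_def child(2)[OF j(1)] path_labels_child[OF j(2)]
        by (simp add: mult_ac)
    qed
    also have "cong \<dots> (a * var Z)"
      by (rule stage_relation_mult[OF v(1) a])
    also have "a * var Z = pivot_monomial v (i # w)"
      unfolding pivot_monomial_def labels a_def using True by (simp add: pvar_def mult_ac)
    finally show ?thesis .
  next
    case False
    have "cong (param_image (pivot_form w (v @ [i]))) (pivot_monomial (v @ [i]) w)"
      using Cons.prems by (intro Cons.IH) simp
    also have "pivot_monomial (v @ [i]) w = pivot_monomial v (i # w)"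
      unfolding pivot_monomial_def labels path_labels_child[OF v(2)]
      using False by (simp add: pvar_def mult_ac)
    finally show ?thesis
      using False by simp
  qed
qed

section \<open>Triangularity of the new coordinates\<close>

definition freer :: "nat \<Rightarrow> (vertex, nat) pol set" where
  "freer n = pol.span (var ` {s \<in> leaves T. n < num_free s})"

lemma freer_antimono: "m \<le> n \<Longrightarrow> freer n \<subseteq> freer m"
  unfolding freer_def by (intro pol.span_mono image_mono) auto

lemma num_free_append_ge: "v @ w \<in> vertices T \<Longrightarrow> num_free v \<le> num_free (v @ w)"
  by (auto simp: num_free_def vertices_def is_vertex_append path_labels_append)

lemma below_freer:
  assumes "v \<in> vertices T" "n < num_free v"
  shows "below v \<in> freer n"
  unfolding below_def freer_def
proof (intro pol.span_sum pol.span_base imageI CollectI conjI)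
  fix r assume "r \<in> leaves_below T v"
  then obtain w where "r \<in> leaves T" "r = v @ w" "v @ w \<in> vertices T"
    by (auto simp: leaves_below_def leaves_def)
  then show "r \<in> leaves T" "n < num_free r"
    using assms num_free_append_ge[of v w] by auto
qed

lemma num_free_child:
  "v @ [i] \<in> vertices T \<Longrightarrow>
     num_free (v @ [i]) = num_free v + (if out_labels T v ! i \<in> Piv then 0 else 1)"
  by (simp add: num_free_def path_labels_child)

lemma num_free_append:
  "v @ w \<in> vertices T \<Longrightarrow>
     num_free (v @ w) = num_free v + length (filter (\<lambda>l. l \<notin> Piv) (path_labels (subtree_at T v) w))"
  by (simp add: num_free_def vertices_def is_vertex_append path_labels_append)

text \<open>
  A copy of \<open>v @ w\<close> other than itself has a step along a non-pivot where \<open>v @ w\<close> has a pivot,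
  and it has the same labels elsewhere; extending it to a leaf only adds further labels.
\<close>

lemma pivot_form_triangular:
  "v @ w \<in> vertices T \<Longrightarrow> pivot_form w v - below (v @ w) \<in> freer (num_free (v @ w))"
proof (induction w arbitrary: v)
  case Nil
  then show ?case
    by (simp add: freer_def pol.span_zero)
next
  case (Cons i w)
  note v = inner_if_extends[OF Cons.prems]
  have IH: "pivot_form w (v @ [i]) - below (v @ i # w) \<in> freer (num_free (v @ i # w))"
    using Cons.IH[of "v @ [i]"] Cons.prems by simp
  show ?case
  proof (cases "out_labels T v ! i \<in> Piv")
    case True
    have other: "pivot_form w (v @ [j]) \<in> freer (num_free (v @ i # w))"
      if j: "j \<in> {..<num_children T v} - {i}" for j
    proof -
      have sub: "rooted_subtree (subtree_at T (v @ [i])) (subtree_at T (v @ [j]))"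
        using pivot_subtree v j True by blast
      have w: "w \<in> vertices (subtree_at T (v @ [i]))"
        using Cons.prems vertices_append_iff[of "v @ [i]" w T] by simp
      then have "w \<in> vertices (subtree_at T (v @ [j]))"
        using sub by (auto simp: rooted_subtree_def)
      moreover have vj: "v @ [j] \<in> vertices T"
        using v j by (simp add: vertices_child_iff inner_vertices_def)
      ultimately have vjw: "(v @ [j]) @ w \<in> vertices T"
        by (simp only: vertices_append_iff)
      have "out_labels T v ! j \<notin> Piv"
        using pivot_unique[OF v(1) v(3) _ True, of j] j by auto
      then have less: "num_free (v @ i # w) < num_free ((v @ [j]) @ w)"
        using num_free_append[OF vjw] num_free_append[of "v @ [i]" w] Cons.prems True v(2) vj
          rooted_subtree_path_labels[OF sub w]
        by (simp add: num_free_child)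
      have "pivot_form w (v @ [j]) - below ((v @ [j]) @ w) \<in> freer (num_free (v @ i # w))"
        using Cons.IH[OF vjw] freer_antimono less less_imp_le by blast
      moreover have "below ((v @ [j]) @ w) \<in> freer (num_free (v @ i # w))"
        by (rule below_freer[OF vjw less])
      ultimately have "pivot_form w (v @ [j]) - below ((v @ [j]) @ w) + below ((v @ [j]) @ w) \<in>
          freer (num_free (v @ i # w))"
        unfolding freer_def by (rule pol.span_add)
      then show ?thesis
        by simp
    qed
    have "pivot_form (i # w) v = pivot_form w (v @ [i]) +
        (\<Sum>j\<in>{..<num_children T v} - {i}. pivot_form w (v @ [j]))"
      using True v by (simp add: sum.remove[of "{..<num_children T v}" i])
    then have "pivot_form (i # w) v - below (v @ i # w) =
        (pivot_form w (v @ [i]) - below (v @ i # w)) +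
        (\<Sum>j\<in>{..<num_children T v} - {i}. pivot_form w (v @ [j]))"
      by simp
    also have "\<dots> \<in> freer (num_free (v @ i # w))"
      using IH other unfolding freer_def by (intro pol.span_add pol.span_sum)
    finally show ?thesis .
  next
    case False
    then show ?thesis
      using IH by simp
  qed
qed

definition leaf_form :: "vertex \<Rightarrow> (vertex, nat) pol" where
  "leaf_form r = pivot_form r []"

definition leaf_monomial :: "vertex \<Rightarrow> ('l param, nat) pol" where
  "leaf_monomial r = pivot_monomial [] r"

lemma leaf_form_triangular: "r \<in> leaves T \<Longrightarrow> leaf_form r - var r \<in> freer (num_free r)"
  using pivot_form_triangular[of "[]" r] leaves_below_leaf[of r T]
  by (simp add: leaf_form_def below_def leaves_def)

lemma leaf_form_linear: "r \<in> leaves T \<Longrightarrow> leaf_form r \<in> linear_forms (leaves T)"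
proof -
  assume r: "r \<in> leaves T"
  have "leaf_form r - var r \<in> linear_forms (leaves T)"
    unfolding linear_forms_def
    by (rule subsetD[OF pol.span_mono leaf_form_triangular[OF r, unfolded freer_def]]) auto
  moreover have "var r \<in> linear_forms (leaves T)"
    using r unfolding linear_forms_def by (intro pol.span_base) auto
  ultimately have "leaf_form r - var r + var r \<in> linear_forms (leaves T)"
    unfolding linear_forms_def by (rule pol.span_add)
  then show ?thesis
    by simp
qed

lemma num_free_le_depth: "r \<in> leaves T \<Longrightarrow> num_free r \<le> depth T"
  using length_leaf_le_depth[of r T] length_filter_le[of "\<lambda>l. l \<notin> Piv" "path_labels T r"]
    length_path_labels[of r T]
  by (simp add: num_free_def leaves_def)

text \<open>
  Downward induction on the number of non-pivots, which is bounded by the depth, inverts the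
  triangular system.
\<close>

lemma var_in_span_leaf_forms:
  assumes "r \<in> leaves T"
  shows "var r \<in> pol.span (leaf_form ` leaves T)"
  using assms
proof (induction "depth T - num_free r" arbitrary: r rule: less_induct)
  case less
  have "freer (num_free r) \<subseteq> pol.span (leaf_form ` leaves T)"
    unfolding freer_def
  proof (rule pol.span_minimal[OF _ pol.subspace_span], rule image_subsetI)
    fix s assume s: "s \<in> {s \<in> leaves T. num_free r < num_free s}"
    then show "var s \<in> pol.span (leaf_form ` leaves T)"
      using num_free_le_depth[of s] by (intro less.hyps) auto
  qed
  then have "leaf_form r - var r \<in> pol.span (leaf_form ` leaves T)"
    using leaf_form_triangular[OF less.prems] by blast
  moreover have "leaf_form r \<in> pol.span (leaf_form ` leaves T)"
    using less.prems by (intro pol.span_base imageI)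
  ultimately have "leaf_form r - (leaf_form r - var r) \<in> pol.span (leaf_form ` leaves T)"
    by (rule pol.span_diff[rotated])
  then show ?case
    by simp
qed

lemma span_leaf_forms: "pol.span (leaf_form ` leaves T) = linear_forms (leaves T)"
proof
  show "pol.span (leaf_form ` leaves T) \<subseteq> linear_forms (leaves T)"
    unfolding linear_forms_def
    by (rule pol.span_minimal[OF _ pol.subspace_span])
       (use leaf_form_linear in \<open>auto simp: linear_forms_def\<close>)
  show "linear_forms (leaves T) \<subseteq> pol.span (leaf_form ` leaves T)"
    unfolding linear_forms_def
    by (rule pol.span_minimal[OF _ pol.subspace_span]) (use var_in_span_leaf_forms in auto)
qed

end

lemma inj_var: "inj (var :: 'x \<Rightarrow> ('x, nat) pol)"
proof (rule injI)
  fix x y :: 'x assume "var x = var y"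
  from arg_cong[OF this, of "eval_pol (\<lambda>c. c) (\<lambda>z. if z = x then 1 else 0)"] show "x = y"
    by (simp split: if_splits)
qed

text \<open>
  Evaluation at the unit vector of the coordinate \<open>x\<close> reads off the coefficient of \<open>var x\<close>.
\<close>

lemma independent_vars: "pol.independent (var ` A)"
  unfolding pol.dependent_explicit
proof (intro notI, elim exE conjE)
  fix V :: "('a, nat) pol set" and u
  assume fin: "finite V" and V: "V \<subseteq> var ` A" and sum: "(\<Sum>v\<in>V. scale (u v) v) = 0"
    and "\<exists>v\<in>V. u v \<noteq> 0"
  then obtain x where x: "var x \<in> V" "u (var x) \<noteq> 0"
    by auto
  let ?e = "eval_pol (\<lambda>c. c) (\<lambda>z. if z = x then 1 else 0 :: real)"
  have "0 = ?e (\<Sum>v\<in>V. scale (u v) v)"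
    by (simp add: sum)
  also have "\<dots> = (\<Sum>v\<in>V. u v * ?e v)"
    by (simp add: real.eval_sum real.eval_scale)
  also have "\<dots> = (\<Sum>v\<in>V. if v = var x then u v else 0)"
    using V by (intro sum.cong refl) (auto dest!: subsetD simp: inj_eq[OF inj_var])
  also have "\<dots> = u (var x)"
    using fin x by simp
  finally show False
    using x by simp
qed

context pivoted_tree
begin

text \<open>
  A family that spans and has no more members than there are independent variables is a
  basis; in particular different leaves have different forms.
\<close>

lemma leaf_forms_basis: "inj_on leaf_form (leaves T)" "pol.independent (leaf_form ` leaves T)"
proof -
  let ?B = "leaf_form ` leaves T"
  have card: "card (leaves T) \<le> card C" if "finite C" "pol.span ?B \<subseteq> pol.span C" for C
  proof -
    have "var ` leaves T \<subseteq> pol.span C"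
      using that var_in_span_leaf_forms by blast
    from pol.independent_span_bound[OF that(1) independent_vars this] show ?thesis
      by (simp add: card_image inj_on_subset[OF inj_var])
  qed
  show inj: "inj_on leaf_form (leaves T)"
  proof (rule eq_card_imp_inj_on[OF finite_leaves])
    show "card ?B = card (leaves T)"
      by (intro antisym card_image_le card finite_imageI finite_leaves order_refl)
  qed
  show "pol.independent ?B"
  proof
    assume "pol.dependent ?B"
    then obtain b where b: "b \<in> ?B" "b \<in> pol.span (?B - {b})"
      unfolding pol.dependent_def by blast
    have "?B \<subseteq> pol.span (?B - {b})"
    proof
      fix b' assume "b' \<in> ?B"
      then show "b' \<in> pol.span (?B - {b})"
        using b(2) pol.span_base[of b' "?B - {b}"] by (cases "b' = b") simp_all
    qed
    then have "pol.span ?B \<subseteq> pol.span (?B - {b})"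
      by (rule pol.span_minimal[OF _ pol.subspace_span])
    then have "card (leaves T) \<le> card (?B - {b})"
      by (intro card) auto
    also have "\<dots> < card ?B"
      using b by (intro card_Diff1_less) auto
    finally show False
      using inj by (simp add: card_image)
  qed
qed

end

section \<open>A criterion for toric structure\<close>

text \<open>
  Toric structure is stated with Laurent polynomials in numbered variables, so the parameters
  are finally numbered and polynomials are embedded into Laurent polynomials.
\<close>

definition rename_exp :: "('x \<Rightarrow> nat) \<Rightarrow> ('x \<Rightarrow>\<^sub>0 nat) \<Rightarrow> (nat \<Rightarrow>\<^sub>0 int)" where
  "rename_exp e m = (\<Sum>x\<in>keys m. single (e x) (int (lookup m x)))"

definition rename_pol :: "('x \<Rightarrow> nat) \<Rightarrow> ('x, nat) pol \<Rightarrow> (nat, int) pol" where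
  "rename_pol e = eval_pol const (\<lambda>x. monomial (single (e x) 1))"

lemma lookup_rename_exp:
  assumes "inj_on e X" "keys m \<subseteq> X" "x \<in> X"
  shows "lookup (rename_exp e m) (e x) = int (lookup m x)"
proof -
  have "lookup (rename_exp e m) (e x) = (\<Sum>y\<in>keys m. if y = x then int (lookup m y) else 0)"
    unfolding rename_exp_def lookup_sum
    using assms by (intro sum.cong refl) (auto simp: lookup_single when_def inj_on_def)
  also have "\<dots> = int (lookup m x)"
    by (simp add: in_keys_iff)
  finally show ?thesis .
qed

lemma inj_on_rename_exp:
  assumes "inj_on e X"
  shows "inj_on (rename_exp e) {m. keys m \<subseteq> X}"
proof (rule inj_onI)
  fix m n :: "'a \<Rightarrow>\<^sub>0 nat"
  assume mn: "m \<in> {m. keys m \<subseteq> X}" "n \<in> {m. keys m \<subseteq> X}" and eq: "rename_exp e m = rename_exp e n"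
  show "m = n"
  proof (rule poly_mapping_eqI)
    fix x
    show "lookup m x = lookup n x"
    proof (cases "x \<in> X")
      case True
      then show ?thesis
        using lookup_rename_exp[OF assms, of m x] lookup_rename_exp[OF assms, of n x] mn eq by simp
    next
      case False
      then have "x \<notin> keys m" "x \<notin> keys n"
        using mn by auto
      then show ?thesis
        by (simp add: in_keys_iff)
    qed
  qed
qed

lemma mon_val_rename:
  "mon_val (\<lambda>x. monomial (single (e x) 1)) m = (monomial (rename_exp e m) :: (nat, int) pol)"
  unfolding mon_val_def rename_exp_def monomial_sum
  by (rule prod.cong[OF refl], rule monomial_single_power[where 'e = int, symmetric])

lemma keys_rename_exp: "keys (rename_exp e m) \<subseteq> e ` keys m"
  unfolding rename_exp_def
  using keys_sum[of "\<lambda>x. single (e x) (int (lookup m x))" "keys m"]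
  by (auto split: if_splits)

lemma rename_pol_monomial: "rename_pol e (monomial m) = monomial (rename_exp e m)"
  by (simp add: rename_pol_def monomial_def[of m] const.eval_single mon_val_rename)

lemma rename_pol_eq_0:
  assumes "inj_on e X" "f \<in> carrier (pol_ring X)" "rename_pol e f = 0"
  shows "f = 0"
proof (rule poly_mapping_eqI)
  fix m
  have "lookup f m = 0" if m: "m \<in> keys f"
  proof -
    have sub: "keys f \<subseteq> {m. keys m \<subseteq> X}"
      using assms(2) by (auto simp: carrier_pol_ring_iff)
    have "0 = lookup (rename_pol e f) (rename_exp e m)"
      by (simp add: assms(3))
    also have "\<dots> = (\<Sum>n\<in>keys f. lookup (single (rename_exp e n) (lookup f n)) (rename_exp e m))"
      by (simp add: rename_pol_def eval_pol_def mon_val_rename lookup_sum flip: single_eq_const_monomial)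
    also have "\<dots> = (\<Sum>n\<in>keys f. if n = m then lookup f n else 0)"
      using inj_onD[OF inj_on_rename_exp[OF assms(1)], of _ m] sub m
      by (intro sum.cong refl) (auto simp: lookup_single when_def)
    also have "\<dots> = lookup f m"
      using m by simp
    finally show ?thesis
      by simp
  qed
  then show "lookup f m = lookup 0 m"
    by (cases "m \<in> keys f") (auto simp: in_keys_iff)
qed

lemma is_monomial_mult:
  "\<exists>m. keys m \<subseteq> X \<and> f = monomial m \<Longrightarrow> \<exists>m. keys m \<subseteq> X \<and> g = monomial m \<Longrightarrow>
   \<exists>m. keys m \<subseteq> X \<and> f * g = monomial m"
  using Poly_Mapping.keys_add by (metis (no_types, lifting) le_sup_iff monomial_add order_trans)

lemma is_monomial_prod_list:
  "(\<And>f. f \<in> set fs \<Longrightarrow> \<exists>m. keys m \<subseteq> X \<and> f = monomial m) \<Longrightarrow>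
   \<exists>m. keys m \<subseteq> X \<and> prod_list fs = monomial m"
proof (induction fs)
  case Nil
  then show ?case
    by (intro exI[of _ 0]) simp
next
  case (Cons f fs)
  then show ?case
    by (simp add: is_monomial_mult)
qed

lemma linear_if_additive:
  assumes "\<And>f g. F (f + g) = F f + F g" "\<And>c f. F (scale c f) = s c (F f)" "vector_space s"
  shows "Vector_Spaces.linear scale s F"
  using assms by (auto simp: Vector_Spaces.linear_def module_hom_def module_hom_axioms_def
    vector_space_def module_def pol.vector_space_assms)

context pivoted_tree
begin

lemma leaf_monomial_is_monomial:
  assumes "r \<in> leaves T"
  shows "\<exists>m. keys m \<subseteq> params \<and> leaf_monomial r = monomial m"
proof -
  have labels: "set (path_labels T r) \<subseteq> label_set T"
    using path_labels_subset[of r] assms by (simp add: leaves_def)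
  have var: "\<exists>m. keys m \<subseteq> params \<and> var x = monomial m" if "x \<in> params" for x
    using that by (intro exI[of _ "single x 1"]) (simp add: var_def)
  have "\<exists>m. keys m \<subseteq> params \<and> prod_list (map var (replicate (depth T - length r) Z @
      map pvar (path_labels T r))) = monomial m"
    using labels by (intro is_monomial_prod_list) (auto intro!: var pvar_in_params)
  then show ?thesis
    by (simp add: leaf_monomial_def pivot_monomial_def comp_def prod_list_replicate)
qed

text \<open>
  An algebra map is determined by its values on the variables \<open>p\<^sub>r\<close>, which are not the new
  coordinates: the linear map with the prescribed values on the basis of the new coordinates
  is evaluated at the \<open>p\<^sub>r\<close>, and agrees with the algebra map on linear forms.
\<close>

lemma coordinates_exist:
  obtains q where
    "\<And>r. r \<in> leaves T \<Longrightarrow> eval_pol const q (leaf_form r) = leaf_monomial r"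
proof -
  interpret P: vector_space_pair
    "scale :: real \<Rightarrow> (vertex, nat) pol \<Rightarrow> _" "scale :: real \<Rightarrow> ('l param, nat) pol \<Rightarrow> _"
    ..
  obtain g where g: "Vector_Spaces.linear scale scale g"
      "\<forall>b\<in>leaf_form ` leaves T. g b = leaf_monomial (the_inv_into (leaves T) leaf_form b)"
    using P.linear_independent_extend[OF leaf_forms_basis(2),
      of "\<lambda>b. leaf_monomial (the_inv_into (leaves T) leaf_form b)"] by blast
  define q where "q s = g (var s)" for s
  have lin: "Vector_Spaces.linear scale scale (eval_pol const q)"
    by (rule linear_if_additive)
       (auto simp: const.eval_add const.eval_scale scale_def[symmetric] pol.vector_space_axioms)
  have "eval_pol const q (leaf_form r) = leaf_monomial r" if r: "r \<in> leaves T" for r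
  proof -
    have "eval_pol const q (leaf_form r) = g (leaf_form r)"
      using leaf_form_linear[OF r] unfolding linear_forms_def
      by (rule P.linear_eq_on[OF lin g(1)]) (auto simp: q_def)
    also have "\<dots> = leaf_monomial r"
      using g(2) r by (simp add: the_inv_into_f_f[OF leaf_forms_basis(1)])
    finally show ?thesis .
  qed
  then show ?thesis
    by (rule that)
qed

lemma tree_ideal_iff:
  "f \<in> tree_ideal T \<longleftrightarrow> f \<in> carrier (pol_ring (leaves T)) \<and> param_image f \<in> sum_ideal T"
proof -
  have "param_image f \<in> carrier (pol_ring params)" if "f \<in> carrier (pol_ring (leaves T))"
    using that by (rule pol_ring_eval) (auto simp: leaves_def intro: path_image_carrier)
  then show ?thesis
    unfolding tree_ideal_def a_kernel_def' leaf_ring_def tree_map_def substitute_eq_eval_pol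
      param_ring_eq
    using coset_eq_ideal_iff[of "param_image f"] by (auto simp: FactRing_def)
qed

lemma sum_ideal_vanishes:
  assumes "f \<in> sum_ideal T"
    and "\<And>v. v \<in> inner_vertices T \<Longrightarrow> (\<Sum>l\<leftarrow>out_labels T v. y (Lab l)) = y Z"
  shows "eval_pol (\<lambda>c. c) y f = 0"
proof -
  have "sum_ideal T \<subseteq> {f \<in> carrier (pol_ring params). eval_pol (\<lambda>c. c) y f = 0}"
    unfolding sum_ideal_def param_ring_eq
  proof (rule ring.genideal_minimal[OF cring.axioms(1)[OF cring_pol_ring] ideal_vanishing])
    show "{(\<Sum>l\<leftarrow>out_labels T v. var (Lab l)) - var Z | v. v \<in> inner_vertices T}
        \<subseteq> {f \<in> carrier (pol_ring params). eval_pol (\<lambda>c. c) y f = 0}"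
      using stage_relations_carrier assms(2)
      by (auto simp: real.eval_diff real.eval_sum_list comp_def)
  qed
  then show ?thesis
    using assms(1) by auto
qed

text \<open>
  The condition says that the monomials of the new coordinates take the same values at
  arbitrary positive points as at points satisfying the stage relations. So if the
  parametrisation kills a polynomial, then its value at the monomials vanishes at the points
  of the second kind, hence at all positive points, and is the zero polynomial. The other
  inclusion of kernels is the congruence of the new coordinates with their monomials.
\<close>

theorem toric_structure_if_points:
  assumes points: "\<And>y :: 'l param \<Rightarrow> real. (\<And>x. y x > 0) \<Longrightarrow>
    \<exists>y'. (\<forall>v\<in>inner_vertices T. (\<Sum>l\<leftarrow>out_labels T v. y' (Lab l)) = y' Z) \<and>
         (\<forall>r\<in>leaves T. eval_pol (\<lambda>c. c) y' (leaf_monomial r) = eval_pol (\<lambda>c. c) y (leaf_monomial r))"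
  shows "toric_structure T"
proof -
  obtain q where q: "\<And>r. r \<in> leaves T \<Longrightarrow> eval_pol const q (leaf_form r) = leaf_monomial r"
    using coordinates_exist by metis
  define \<pi> where "\<pi> = eval_pol const q"
  obtain e :: "'l param \<Rightarrow> nat" and N where e: "inj_on e params" "e ` params = {..<N}"
    using finite_imp_inj_to_nat_seg[OF finite_params] by (auto simp: lessThan_def)
  define \<psi> where "\<psi> = rename_pol e \<circ> \<pi>"
  define B where "B = leaf_form ` leaves T"
  have var_lf: "var r \<in> pol.span B" if "r \<in> leaves T" for r
    using var_in_span_leaf_forms[OF that] by (simp add: B_def)

  \<comment> \<open>Both maps are linear and congruent on the basis of new coordinates, hence on the old ones.\<close>
  have q_cong: "cong (q r) (path_image T r)" if r: "r \<in> leaves T" for r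
  proof -
    have "pol.span B \<subseteq> {f. cong (\<pi> f) (param_image f)}"
    proof (rule pol.span_minimal)
      show "B \<subseteq> {f. cong (\<pi> f) (param_image f)}"
      proof
        fix b assume "b \<in> B"
        then obtain s where s: "s \<in> leaves T" "b = leaf_form s"
          by (auto simp: B_def)
        have *: "cong (param_image b) (\<pi> b)"
          using image_pivot_form[of "[]" s] q[OF s(1)] s
          by (simp add: leaves_def leaf_form_def leaf_monomial_def \<pi>_def)
        then have "cong (\<pi> b) (param_image b)"
          using ideal_uminus[of "param_image b - \<pi> b"] by (simp add: cong_def)
        then show "b \<in> {f. cong (\<pi> f) (param_image f)}"
          by simp
      qed
      show "pol.subspace {f. cong (\<pi> f) (param_image f)}"
        unfolding pol.subspace_def
        by (auto simp: \<pi>_def const.eval_add const.eval_scale scale_def[symmetric]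
          intro: cong_add cong_scale cong_refl)
    qed
    then have "cong (\<pi> (var r)) (param_image (var r))"
      using var_lf[OF r] by blast
    then show ?thesis
      by (simp add: \<pi>_def)
  qed
  have \<pi>_carrier: "\<pi> f \<in> carrier (pol_ring params)" if "f \<in> carrier (pol_ring (leaves T))" for f
    unfolding \<pi>_def using that q_cong by (intro pol_ring_eval) (auto simp: cong_def)

  have kernel: "param_image f \<in> sum_ideal T \<longleftrightarrow> \<psi> f = 0"
    if f: "f \<in> carrier (pol_ring (leaves T))" for f
  proof
    have \<pi>_cong: "cong (\<pi> f) (param_image f)"
      unfolding \<pi>_def using f q_cong by (rule cong_eval)
    {
      assume "\<psi> f = 0"
      then have "\<pi> f = 0"
        using rename_pol_eq_0[OF e(1) \<pi>_carrier[OF f]] by (simp add: \<psi>_def)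
      then show "param_image f \<in> sum_ideal T"
        using cong_ideal_iff[OF \<pi>_cong] ideal_0 by simp
    next
      assume "param_image f \<in> sum_ideal T"
      then have \<pi>f: "\<pi> f \<in> sum_ideal T"
        using cong_ideal_iff[OF \<pi>_cong] by simp
      have "\<pi> f = 0"
      proof (rule eval_pos_imp_0)
        fix y :: "'l param \<Rightarrow> real" assume y: "\<And>x. y x > 0"
        from points[of y, OF y] obtain y' where
          y': "\<And>v. v \<in> inner_vertices T \<Longrightarrow> (\<Sum>l\<leftarrow>out_labels T v. y' (Lab l)) = y' Z"
            "\<And>r. r \<in> leaves T \<Longrightarrow>
               eval_pol (\<lambda>c. c) y' (leaf_monomial r) = eval_pol (\<lambda>c. c) y (leaf_monomial r)"
          by blast
        \<comment> \<open>The two points agree on the monomials of the basis, hence on the images of the \<open>p\<^sub>r\<close>.\<close>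
        have "pol.span B \<subseteq> {b. eval_pol (\<lambda>c. c) y' (\<pi> b) = eval_pol (\<lambda>c. c) y (\<pi> b)}"
        proof (rule pol.span_minimal)
          show "pol.subspace {b. eval_pol (\<lambda>c. c) y' (\<pi> b) = eval_pol (\<lambda>c. c) y (\<pi> b)}"
            unfolding pol.subspace_def
            by (auto simp: \<pi>_def const.eval_add const.eval_scale scale_def[symmetric]
              real.eval_add real.eval_scale)
        qed (auto simp: B_def \<pi>_def q y'(2))
        then have same: "eval_pol (\<lambda>c. c) y' (q r) = eval_pol (\<lambda>c. c) y (q r)" if "r \<in> leaves T" for r
          using var_lf[OF that] by (auto simp: \<pi>_def)
        have "eval_pol (\<lambda>c. c) y (\<pi> f) = eval_pol (\<lambda>c. c) (\<lambda>r. eval_pol (\<lambda>c. c) y (q r)) f"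
          unfolding \<pi>_def by (rule real.eval_eval)
        also have "\<dots> = eval_pol (\<lambda>c. c) (\<lambda>r. eval_pol (\<lambda>c. c) y' (q r)) f"
          by (rule eval_pol_cong[OF f]) (simp add: same)
        also have "\<dots> = eval_pol (\<lambda>c. c) y' (\<pi> f)"
          unfolding \<pi>_def by (rule real.eval_eval[symmetric])
        also have "\<dots> = 0"
          using \<pi>f y'(1) by (rule sum_ideal_vanishes)
        finally show "eval_pol (\<lambda>c. c) y (\<pi> f) = 0" .
      qed
      then show "\<psi> f = 0"
        by (simp add: \<psi>_def rename_pol_def)
    }
  qed

  have "\<psi> f \<in> carrier (pol_ring {..<N})" if "f \<in> carrier (pol_ring (leaves T))" for f
    unfolding \<psi>_def comp_def rename_pol_def
    by (rule pol_ring_eval[OF \<pi>_carrier[OF that]]) (use e(2) in auto)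
  then have hom: "\<psi> \<in> alg_hom (leaf_ring T) (pol_ring {..<N})"
    by (auto simp: alg_hom_def leaf_ring_def \<psi>_def rename_pol_def \<pi>_def const.eval_add
      const.eval_mult intro!: ring_hom_memI)
  have mono: "\<exists>m. keys m \<subseteq> {..<N} \<and> \<psi> l = monomial m" if l: "l \<in> B" for l
  proof -
    obtain r where r: "r \<in> leaves T" "l = leaf_form r"
      using l by (auto simp: B_def)
    obtain m where m: "keys m \<subseteq> params" "leaf_monomial r = monomial m"
      using leaf_monomial_is_monomial[OF r(1)] by blast
    have "\<psi> l = monomial (rename_exp e m)"
      using q[OF r(1)] r(2) m(2) by (simp add: \<psi>_def \<pi>_def rename_pol_monomial)
    moreover have "keys (rename_exp e m) \<subseteq> {..<N}"
      using keys_rename_exp[of e m] m(1) e(2) by blast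
    ultimately show ?thesis
      by blast
  qed
  have "tree_ideal T = a_kernel (leaf_ring T) (pol_ring {..<N}) \<psi>"
    using kernel by (auto simp: tree_ideal_iff a_kernel_def' leaf_ring_def)
  then show ?thesis
    unfolding toric_structure_def
    using leaf_forms_basis(2) span_leaf_forms hom mono by (metis B_def)
qed

end

section \<open>Normalising the labels of a balanced tree\<close>

lemma leaves_Node:
  "leaves (Node c ts) = (\<Union>i<length ts. (#) i ` leaves (snd (ts ! i)))"
  by (auto simp: leaves_def vertices_Node)

lemma tree_pol_Leaf: "tree_pol (Leaf :: ('c, 'l) stree) = 1"
proof -
  have "leaves (Leaf :: ('c, 'l) stree) = {[]}"
    by (auto simp: leaves_def vertices_def elim: is_vertex.elims)
  then show ?thesis
    by (simp add: tree_pol_def)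
qed

lemma tree_pol_Node:
  "tree_pol (Node c ts) = (\<Sum>i<length ts. var (fst (ts ! i)) * tree_pol (snd (ts ! i)))"
proof -
  have "tree_pol (Node c ts) = (\<Sum>i<length ts. \<Sum>r\<in>(#) i ` leaves (snd (ts ! i)).
      prod_list (map var (path_labels (Node c ts) r)))"
    unfolding tree_pol_def leaves_Node by (rule sum.UNION_disjoint) auto
  then show ?thesis
    by (simp add: sum.reindex tree_pol_def sum_distrib_left)
qed

lemma tree_pol_inner:
  assumes "v \<in> inner_vertices T"
  shows "tree_pol (subtree_at T v) =
    (\<Sum>i<num_children T v. var (out_labels T v ! i) * tree_pol (subtree_at T (v @ [i])))"
  using assms
  by (cases "subtree_at T v")
     (auto simp: inner_vertices_def tree_pol_Node num_children_def out_labels_def subtree_at_append)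

lemma staged_tree_subtree:
  assumes "staged_tree T" "rooted_subtree S T"
  shows "inner_vertices S \<subseteq> inner_vertices T" "staged_tree S"
proof -
  show sub: "inner_vertices S \<subseteq> inner_vertices T"
  proof
    fix v assume v: "v \<in> inner_vertices S"
    then have "v \<in> vertices T" "stage S v = stage T v"
      using assms(2) by (auto simp: rooted_subtree_def inner_vertices_def)
    moreover have "stage S v \<noteq> None"
      using v by (cases "subtree_at S v") (auto simp: inner_vertices_def stage_def)
    ultimately show "v \<in> inner_vertices T"
      by (auto simp: inner_vertices_def stage_def)
  qed
  have same: "stage S v = stage T v" "out_labels S v = out_labels T v" if "v \<in> inner_vertices S" for v
    using assms(2) that by (simp_all add: rooted_subtree_def)
  show "staged_tree S"
    unfolding staged_tree_def
  proof (intro conjI ballI impI)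
    fix v assume v: "v \<in> inner_vertices S"
    show "distinct (out_labels S v)" "2 \<le> num_children S v"
      using staged_tree_inner[OF assms(1), of v] sub v same[OF v] by (auto simp: num_children_def)
    fix u assume u: "u \<in> inner_vertices S"
    show "out_labels S v = out_labels S u" if "stage S v = stage S u"
      using assms(1) that sub u v same[OF u] same[OF v] unfolding staged_tree_def by (metis subsetD)
    show "set (out_labels S v) \<inter> set (out_labels S u) = {}" if "stage S v \<noteq> stage S u"
      using assms(1) that sub u v same[OF u] same[OF v] unfolding staged_tree_def by (metis subsetD)
  qed
qed

text \<open>
  A label determines its stage and its position among the outgoing labels, so numbers can be
  attached to labels by describing them at any vertex of the stage.
\<close>

lemma staged_tree_label_cases:
  assumes "staged_tree T" "u \<in> inner_vertices T" "v \<in> inner_vertices T"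
    "i < num_children T u" "j < num_children T v" "out_labels T u ! i = out_labels T v ! j"
  shows "stage T u = stage T v" "out_labels T u = out_labels T v" "i = j"
proof -
  have "out_labels T u ! i \<in> set (out_labels T u) \<inter> set (out_labels T v)"
    using assms(4-6) by (metis IntI nth_mem num_children_def)
  then show s: "stage T u = stage T v"
    using assms(1-3) unfolding staged_tree_def by blast
  then show l: "out_labels T u = out_labels T v"
    using assms(1-3) unfolding staged_tree_def by blast
  show "i = j"
    using staged_tree_inner(1)[OF assms(1,2)] assms(4-6) l
    by (simp add: num_children_def nth_eq_iff_index_eq)
qed

text \<open>
  The labels are evaluated at arbitrary positive numbers, without conditions on their sums;
  the value of \<open>t(v)\<close> at these numbers is the weight of \<open>v\<close>.
\<close>

locale balanced_staged_tree =
  fixes S :: "('c, 'l) stree" and \<omega> :: "'l \<Rightarrow> real"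
  assumes staged: "staged_tree S"
    and balanced: "balanced S"
    and pos: "\<omega> l > 0"
begin

definition weight :: "vertex \<Rightarrow> real" where
  "weight v = eval_pol (\<lambda>c. c) \<omega> (tree_pol (subtree_at S v))"

lemma weight_leaf: "v \<in> leaves S \<Longrightarrow> weight v = 1"
  by (simp add: weight_def leaves_def tree_pol_Leaf)

lemma weight_inner:
  "v \<in> inner_vertices S \<Longrightarrow>
     weight v = (\<Sum>i<num_children S v. \<omega> (out_labels S v ! i) * weight (v @ [i]))"
  by (simp add: weight_def tree_pol_inner real.eval_sum real.eval_mult)

lemma weight_pos: "v \<in> vertices S \<Longrightarrow> weight v > 0"
proof (induction "depth S - length v" arbitrary: v rule: less_induct)
  case less
  show ?case
    using \<open>v \<in> vertices S\<close>
  proof (cases rule: vertices_cases)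
    case 1
    then show ?thesis
      by (simp add: weight_leaf)
  next
    case 2
    have n: "num_children S v \<noteq> 0"
      using staged_tree_inner(2)[OF staged 2] by simp
    have "weight (v @ [i]) > 0" if "i < num_children S v" for i
    proof -
      have "v @ [i] \<in> vertices S"
        using that less.prems by (simp add: vertices_child_iff)
      then show ?thesis
        using length_vertex_le_depth[OF staged, of "v @ [i]"] by (intro less.hyps) auto
    qed
    then show ?thesis
      unfolding weight_inner[OF 2] using n pos by (intro sum_pos mult_pos_pos) auto
  qed
qed

text \<open>
  Adding up the relations \<open>t(u\<^sub>i) t(v\<^sub>j) = t(u\<^sub>j) t(v\<^sub>i)\<close> over \<open>j\<close>, multiplied by the common labels
  \<open>\<theta>\<^sub>j\<close>, gives \<open>t(u\<^sub>i) t(v) = t(u) t(v\<^sub>i)\<close>.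
\<close>

lemma weight_balanced:
  assumes "u \<in> inner_vertices S" "v \<in> inner_vertices S" "stage S u = stage S v"
    "out_labels S u = out_labels S v" "i < num_children S u"
  shows "weight (u @ [i]) / weight u = weight (v @ [i]) / weight v"
proof -
  have n: "num_children S u = num_children S v"
    using assms(4) by (simp add: num_children_def)
  have cross: "weight (u @ [i]) * weight (v @ [j]) = weight (u @ [j]) * weight (v @ [i])"
    if j: "j < num_children S v" for j
  proof -
    have "tree_pol (subtree_at S (u @ [i])) * tree_pol (subtree_at S (v @ [j])) =
        tree_pol (subtree_at S (u @ [j])) * tree_pol (subtree_at S (v @ [i]))"
      using balanced assms(1-3,5) j n unfolding balanced_def inner_vertices_def by simp
    from arg_cong[OF this, of "eval_pol (\<lambda>c. c) \<omega>"] show ?thesis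
      by (simp add: weight_def real.eval_mult)
  qed
  have "weight (u @ [i]) * weight v = weight u * weight (v @ [i])"
    unfolding weight_inner[OF assms(1)] weight_inner[OF assms(2)] sum_distrib_left sum_distrib_right n
    using cross assms(4) by (intro sum.cong) (auto simp: algebra_simps)
  moreover have "weight u > 0" "weight v > 0"
    using assms weight_pos by (auto simp: inner_vertices_def)
  ultimately show ?thesis
    by (simp add: field_simps)
qed

text \<open>
  These are the conditional probabilities of the distribution that gives each root-to-leaf
  path a probability proportional to the product of its labels. In a balanced tree they
  are constant on stages and can therefore replace the labels.
\<close>

lemma normalised_labels:
  obtains \<sigma> where "\<And>v i. v \<in> inner_vertices S \<Longrightarrow> i < num_children S v \<Longrightarrow>
    \<sigma> (out_labels S v ! i) = \<omega> (out_labels S v ! i) * weight (v @ [i]) / weight v"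
proof -
  have "\<exists>x. \<forall>v i. v \<in> inner_vertices S \<longrightarrow> i < num_children S v \<longrightarrow> l = out_labels S v ! i \<longrightarrow>
      x = \<omega> l * weight (v @ [i]) / weight v" for l
  proof (cases "\<exists>u j. u \<in> inner_vertices S \<and> j < num_children S u \<and> l = out_labels S u ! j")
    case True
    then obtain u j where u: "u \<in> inner_vertices S" "j < num_children S u" "l = out_labels S u ! j"
      by blast
    show ?thesis
    proof (intro exI[of _ "\<omega> l * weight (u @ [j]) / weight u"] allI impI)
      fix v i assume v: "v \<in> inner_vertices S" "i < num_children S v" "l = out_labels S v ! i"
      have "stage S u = stage S v" "out_labels S u = out_labels S v" "j = i"
        using staged_tree_label_cases[OF staged u(1) v(1) u(2) v(2)] u v by auto
      then show "\<omega> l * weight (u @ [j]) / weight u = \<omega> l * weight (v @ [i]) / weight v"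
        using weight_balanced[OF u(1) v(1) _ _ u(2)] by (simp flip: times_divide_eq_right)
    qed
  qed blast
  then show ?thesis
    using that by metis
qed

end

text \<open>
  The inner vertices of \<open>T\<close> are those of \<open>S\<close>, called upper, and the lower ones, which are the
  inner vertices of the trees \<open>T(v)\<close> for leaves \<open>v\<close> of \<open>S\<close>.
\<close>

locale staged_subtree =
  fixes T S :: "('c, 'l) stree"
  assumes staged_T: "staged_tree T"
    and sub: "rooted_subtree S T"
begin

lemmas inner_sub = staged_tree_subtree(1)[OF staged_T sub]
lemmas staged_S = staged_tree_subtree(2)[OF staged_T sub]

lemma out_labels_S: "v \<in> inner_vertices S \<Longrightarrow> out_labels S v = out_labels T v"
  and num_children_S: "v \<in> inner_vertices S \<Longrightarrow> num_children S v = num_children T v"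
  using sub by (simp_all add: rooted_subtree_def num_children_def)

lemma vertex_cases:
  assumes "v \<in> vertices T"
  obtains "v \<in> inner_vertices S" | u w where "u \<in> leaves S" "v = u @ w"
proof -
  have "v \<in> inner_vertices S \<or> (\<exists>u w. u \<in> leaves S \<and> v = u @ w)"
    using assms
  proof (induction v rule: rev_induct)
    case Nil
    show ?case
      using Nil_in_vertices[of S] by (cases rule: vertices_cases) auto
  next
    case (snoc i v)
    then have "v \<in> vertices T" "i < num_children T v"
      by (simp_all add: vertices_child_iff)
    with snoc.IH consider "v \<in> inner_vertices S" | u w where "u \<in> leaves S" "v = u @ w"
      by blast
    then show ?case
    proof cases
      case 1
      then have "v @ [i] \<in> vertices S"
        using \<open>i < num_children T v\<close>
        by (simp add: vertices_child_iff num_children_S inner_vertices_def)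
      then show ?thesis
        by (cases rule: vertices_cases) auto
    qed auto
  qed
  then show ?thesis
    using that by blast
qed

definition lower :: "vertex set" where
  "lower = inner_vertices T - inner_vertices S"

lemma lower_if_extends_leaf:
  assumes "u \<in> leaves S" "(u @ w) @ [i] \<in> vertices T"
  shows "u @ w \<in> lower"
proof -
  have "u @ w \<notin> inner_vertices S"
    using leaf_append_iff[OF assms(1), of w] assms(1)
    by (auto simp: inner_vertices_def leaves_def)
  then show ?thesis
    using inner_if_child[OF assms(2)] by (simp add: lower_def)
qed

text \<open>
  A path runs through upper vertices first, where the quotients of the weights telescope up
  to the weight one of a leaf of \<open>S\<close>; on its lower part the two labellings agree.
\<close>

lemma telescoping_path:
  fixes \<omega> \<omega>' :: "'l \<Rightarrow> real"
  assumes w_pos: "\<And>v. v \<in> vertices S \<Longrightarrow> w v > 0"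
    and w_leaf: "\<And>v. v \<in> leaves S \<Longrightarrow> w v = 1"
    and upper: "\<And>v i. v \<in> inner_vertices S \<Longrightarrow> i < num_children S v \<Longrightarrow>
      \<omega>' (out_labels S v ! i) = \<omega> (out_labels S v ! i) * w (v @ [i]) / w v"
    and lower: "\<And>v i. v \<in> lower \<Longrightarrow> i < num_children T v \<Longrightarrow>
      \<omega>' (out_labels T v ! i) = \<omega> (out_labels T v ! i)"
    and r: "r \<in> leaves T"
  shows "(\<Prod>l\<leftarrow>path_labels T r. \<omega>' l) = (\<Prod>l\<leftarrow>path_labels T r. \<omega> l) / w []"
proof -
  have "r \<in> vertices T" "r \<notin> inner_vertices S"
    using r inner_sub by (auto simp: leaves_def inner_vertices_def)
  from \<open>r \<in> vertices T\<close> \<open>r \<notin> inner_vertices S\<close>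
  obtain u v where u: "u \<in> leaves S" and uv: "r = u @ v"
    by (cases rule: vertex_cases) auto
  with \<open>r \<in> vertices T\<close> have uv_vertex: "u @ v \<in> vertices T"
    by simp
  have "(\<Prod>l\<leftarrow>path_labels T u. \<omega>' l) = (\<Prod>l\<leftarrow>path_labels T u. \<omega> l) * w u / w []"
    using u[unfolded leaves_def, THEN CollectD, THEN conjunct1]
  proof (induction u rule: rev_induct)
    case Nil
    then show ?case
      using w_pos[of "[]"] by simp
  next
    case (snoc i u)
    then have u: "u \<in> vertices S" "u \<in> inner_vertices S" "i < num_children S u"
      by (auto simp: vertices_child_iff intro: inner_if_child)
    have "u @ [i] \<in> vertices T"
      using snoc.prems sub by (auto simp: rooted_subtree_def)
    then show ?case
      using snoc.IH[OF u(1)] w_pos[OF u(1)] upper[OF u(2,3)]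
      by (simp add: path_labels_child out_labels_S[OF u(2)])
  qed
  then have top: "(\<Prod>l\<leftarrow>path_labels T u. \<omega>' l) = (\<Prod>l\<leftarrow>path_labels T u. \<omega> l) / w []"
    using w_leaf[OF u] by simp
  have "(\<Prod>l\<leftarrow>path_labels T (u @ v). \<omega>' l) = (\<Prod>l\<leftarrow>path_labels T (u @ v). \<omega> l) / w []"
    using uv_vertex
  proof (induction v rule: rev_induct)
    case Nil
    then show ?case
      using top by simp
  next
    case (snoc i v)
    then have T: "(u @ v) @ [i] \<in> vertices T"
      by simp
    then have "u @ v \<in> vertices T" "i < num_children T (u @ v)"
      by (simp_all only: vertices_child_iff)
    then show ?case
      using lower[OF lower_if_extends_leaf[OF u T], of i] snoc.IH path_labels_child[OF T] by simp
  qed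
  then show ?thesis
    by (simp only: uv)
qed

end

context pivoted_tree
begin

text \<open>
  The monomials of the new coordinates are homogeneous of degree \<open>depth T\<close>.
\<close>

lemma eval_leaf_monomial:
  fixes x :: "'l param \<Rightarrow> real"
  assumes r: "r \<in> leaves T" and x: "\<And>l. x (pvar l) = x Z * f l"
  shows "eval_pol (\<lambda>c. c) x (leaf_monomial r) = x Z ^ depth T * (\<Prod>l\<leftarrow>path_labels T r. f l)"
proof -
  have "(\<Prod>l\<leftarrow>ls. x Z * f l) = x Z ^ length ls * (\<Prod>l\<leftarrow>ls. f l)" for ls
    by (induction ls) auto
  moreover have "length (path_labels T r) = length r"
    using r by (intro length_path_labels) (simp add: leaves_def)
  ultimately have "(\<Prod>l\<leftarrow>path_labels T r. x (pvar l)) = x Z ^ length r * (\<Prod>l\<leftarrow>path_labels T r. f l)"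
    by (simp add: x)
  then have "eval_pol (\<lambda>c. c) x (leaf_monomial r) =
      x Z ^ (depth T - length r) * (x Z ^ length r * (\<Prod>l\<leftarrow>path_labels T r. f l))"
    by (simp add: leaf_monomial_def pivot_monomial_def real.eval_mult real.eval_power
      real.eval_prod_list comp_def)
  then show ?thesis
    using length_leaf_le_depth[OF r] by (simp flip: power_add mult.assoc)
qed

end

section \<open>Balanced trees with subtree inclusion below\<close>

locale balanced_above_pivots = pivoted_tree T Piv + staged_subtree T S
  for T S :: "('c, 'l) stree" and Piv +
  assumes balanced: "balanced S"
    and upper_label: "\<And>v i. v \<in> inner_vertices S \<Longrightarrow> i < num_children T v \<Longrightarrow> out_labels T v ! i \<notin> Piv"
    and lower_label: "\<And>v i. v \<in> lower \<Longrightarrow> i < num_children T v \<Longrightarrow> out_labels T v ! i \<notin> label_set S"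
    and lower_pivot: "\<And>v. v \<in> lower \<Longrightarrow> \<exists>i<num_children T v. out_labels T v ! i \<in> Piv"
begin

lemma label_set_S: "v \<in> inner_vertices S \<Longrightarrow> i < num_children T v \<Longrightarrow> out_labels T v ! i \<in> label_set S"
  by (force simp: label_set_def num_children_def out_labels_S)

lemma pivot_notin_label_set: "l \<in> Piv \<Longrightarrow> l \<notin> label_set S"
  using upper_label out_labels_S by (auto simp: label_set_def in_set_conv_nth num_children_def)

text \<open>
  After dividing by \<open>z\<close> and setting the pivots to one, the labels become numbers \<open>\<omega>\<close>. The upper
  ones are normalised, which divides the monomial of every leaf by the weight \<open>t\<close> of the
  root; then everything is scaled by a number \<open>\<zeta>\<close> that restores the factors \<open>z\<close> and \<open>t\<close>. The
  pivots take whatever is left at their stage, which may well be negative.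
\<close>

lemma stochastic_point:
  fixes y :: "'l param \<Rightarrow> real"
  assumes y: "\<And>x. y x > 0"
  obtains y' where "\<And>v. v \<in> inner_vertices T \<Longrightarrow> (\<Sum>l\<leftarrow>out_labels T v. y' (Lab l)) = y' Z"
    "\<And>r. r \<in> leaves T \<Longrightarrow>
       eval_pol (\<lambda>c. c) y' (leaf_monomial r) = eval_pol (\<lambda>c. c) y (leaf_monomial r)"
proof -
  define z where "z = y Z"
  define \<omega> where "\<omega> l = (if l \<in> Piv then 1 else y (Lab l) / z)" for l
  have z: "z > 0"
    using y by (simp add: z_def)
  interpret W: balanced_staged_tree S \<omega>
    by unfold_locales (use staged_S balanced y z in \<open>auto simp: \<omega>_def\<close>)
  obtain \<sigma> where \<sigma>: "\<And>v i. v \<in> inner_vertices S \<Longrightarrow> i < num_children S v \<Longrightarrow>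
      \<sigma> (out_labels S v ! i) = \<omega> (out_labels S v ! i) * W.weight (v @ [i]) / W.weight v"
    using W.normalised_labels by metis
  define t where "t = W.weight []"
  have t: "t > 0"
    by (simp add: t_def W.weight_pos)
  \<comment> \<open>If the depth is 0, there is no exponent to absorb \<open>t\<close>, but then \<open>S\<close> is a leaf and \<open>t = 1\<close>.\<close>
  obtain \<zeta> where \<zeta>: "\<zeta> ^ depth T = z ^ depth T * t"
  proof (cases "depth T = 0")
    case True
    have "v = []" if "v \<in> vertices S" for v
      using sub that length_vertex_le_depth[OF staged, of v] True by (auto simp: rooted_subtree_def)
    moreover have "[0] \<in> vertices S" if "[] \<in> inner_vertices S"
      using staged_tree_inner(2)[OF staged_S that] vertices_child_iff[of "[]" 0 S] by simp
    ultimately have "[] \<in> leaves S"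
      using Nil_in_vertices[of S] by (metis list.distinct(1) vertices_cases)
    then show ?thesis
      using that[of 1] True by (simp add: t_def W.weight_leaf)
  next
    case False
    then show ?thesis
      using that[of "z * root (depth T) t"] t by (simp add: power_mult_distrib)
  qed
  define \<omega>' where "\<omega>' l = (if l \<in> label_set S then \<sigma> l else \<omega> l)" for l
  have upper: "\<omega>' (out_labels S v ! i) = \<omega> (out_labels S v ! i) * W.weight (v @ [i]) / W.weight v"
    if "v \<in> inner_vertices S" "i < num_children S v" for v i
    using \<sigma>[OF that] label_set_S[of v i] that
    by (simp add: \<omega>'_def out_labels_S num_children_S)
  have lower: "\<omega>' (out_labels T v ! i) = \<omega> (out_labels T v ! i)"
    if "v \<in> lower" "i < num_children T v" for v i
    using lower_label[OF that] by (simp add: \<omega>'_def)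
  \<comment> \<open>The set of labels that share their stage with \<open>l\<close>.\<close>
  define siblings where "siblings l = set (out_labels T (SOME v. v \<in> inner_vertices T \<and> l \<in> set (out_labels T v)))" for l
  have siblings: "siblings l = set (out_labels T v)" if v: "v \<in> inner_vertices T" "l \<in> set (out_labels T v)" for v l
    unfolding siblings_def
  proof (rule someI2[of _ v])
    fix u assume "u \<in> inner_vertices T \<and> l \<in> set (out_labels T u)"
    then show "set (out_labels T u) = set (out_labels T v)"
      using v staged_tree_disjoint_or_equal[OF staged, of u v] by auto
  qed (use v in simp)
  define y' where "y' x = (case x of Z \<Rightarrow> \<zeta> | Lab l \<Rightarrow>
    if l \<in> Piv then \<zeta> * (1 - (\<Sum>l'\<in>siblings l - Piv. \<omega> l')) else \<zeta> * \<omega>' l)" for x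
  show thesis
  proof (rule that[of y'])
    fix v assume v: "v \<in> inner_vertices T"
    show "(\<Sum>l\<leftarrow>out_labels T v. y' (Lab l)) = y' Z"
    proof (cases "v \<in> inner_vertices S")
      case True
      have "(\<Sum>l\<leftarrow>out_labels T v. y' (Lab l)) = (\<Sum>i<num_children T v. y' (Lab (out_labels T v ! i)))"
        by (simp add: sum_list_sum_nth num_children_def atLeast0LessThan)
      also have "\<dots> = (\<Sum>i<num_children S v.
          \<zeta> / W.weight v * (\<omega> (out_labels S v ! i) * W.weight (v @ [i])))"
        unfolding num_children_S[OF True]
        using upper_label[OF True] upper[OF True]
        by (intro sum.cong) (auto simp: y'_def out_labels_S[OF True] num_children_S[OF True])
      also have "\<dots> = \<zeta> / W.weight v * W.weight v"
        by (simp add: W.weight_inner[OF True] sum_distrib_left)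
      also have "\<dots> = y' Z"
        using W.weight_pos[of v] True by (simp add: y'_def inner_vertices_def)
      finally show ?thesis .
    next
      case False
      then have low: "v \<in> lower"
        using v by (simp add: lower_def)
      let ?L = "set (out_labels T v)"
      obtain p where p: "p < num_children T v" "out_labels T v ! p \<in> Piv"
        using lower_pivot[OF low] by blast
      have pL: "out_labels T v ! p \<in> ?L"
        using p(1) by (simp add: num_children_def)
      have "l = out_labels T v ! p" if l: "l \<in> ?L" "l \<in> Piv" for l
      proof -
        obtain i where "i < num_children T v" "l = out_labels T v ! i"
          using l(1) by (auto simp: in_set_conv_nth num_children_def)
        then show ?thesis
          using pivot_unique[OF v p(1), of i] p(2) l(2) by simp
      qed
      then have LPiv: "?L - Piv = ?L - {out_labels T v ! p}"
        using p(2) by blast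
      have "(\<Sum>l\<leftarrow>out_labels T v. y' (Lab l)) = (\<Sum>l\<in>?L. y' (Lab l))"
        using staged_tree_inner(1)[OF staged v] by (rule sum_list_distinct_conv_sum_set)
      also have "\<dots> = y' (Lab (out_labels T v ! p)) + (\<Sum>l\<in>?L - Piv. y' (Lab l))"
        unfolding LPiv using pL by (simp add: sum.remove)
      also have "(\<Sum>l\<in>?L - Piv. y' (Lab l)) = (\<Sum>l\<in>?L - Piv. \<zeta> * \<omega> l)"
        using lower[OF low] by (intro sum.cong) (auto simp: y'_def in_set_conv_nth num_children_def)
      also have "y' (Lab (out_labels T v ! p)) + \<dots> = y' Z"
        using p(2) siblings[OF v pL] by (simp add: y'_def algebra_simps sum_distrib_left)
      finally show ?thesis .
    qed
  next
    fix r assume r: "r \<in> leaves T"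
    have "eval_pol (\<lambda>c. c) y' (leaf_monomial r) = \<zeta> ^ depth T * (\<Prod>l\<leftarrow>path_labels T r. \<omega>' l)"
      using eval_leaf_monomial[OF r, of y' \<omega>'] pivot_notin_label_set
      by (simp add: pvar_def y'_def \<omega>'_def \<omega>_def)
    also have "\<dots> = z ^ depth T * (\<Prod>l\<leftarrow>path_labels T r. \<omega> l)"
      using telescoping_path[of W.weight \<omega>' \<omega>, OF W.weight_pos W.weight_leaf upper lower r] \<zeta> t
      by (simp add: t_def)
    also have "\<dots> = eval_pol (\<lambda>c. c) y (leaf_monomial r)"
      using eval_leaf_monomial[OF r, of y \<omega>] z by (simp add: pvar_def \<omega>_def z_def)
    finally show "eval_pol (\<lambda>c. c) y' (leaf_monomial r) = eval_pol (\<lambda>c. c) y (leaf_monomial r)" .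
  qed
qed

lemma toric: "toric_structure T"
proof (rule toric_structure_if_points)
  fix y :: "'l param \<Rightarrow> real" assume y: "\<And>x. y x > 0"
  show "\<exists>y'. (\<forall>v\<in>inner_vertices T. (\<Sum>l\<leftarrow>out_labels T v. y' (Lab l)) = y' Z) \<and>
    (\<forall>r\<in>leaves T. eval_pol (\<lambda>c. c) y' (leaf_monomial r) = eval_pol (\<lambda>c. c) y (leaf_monomial r))"
    using stochastic_point[of y, OF y] by metis
qed

end

theorem theorem5p4:
  fixes T S :: "('c, 'l) stree"
  assumes "staged_tree T"
    and "rooted_subtree S T"
    and "balanced S"
    and "\<forall>u\<in>inner_vertices S. \<forall>v\<in>leaves S. \<forall>w\<in>vertices (subtree_at T v).
           stage T u \<noteq> stage T (v @ w)"
    and "\<forall>v\<in>leaves S. \<forall>w\<in>inner_vertices (subtree_at T v). \<forall>c.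
           stage T (v @ w) = Some c \<longrightarrow> has_subtree_inclusion T c"
  shows "toric_structure T"
proof -
  interpret staged_subtree T S
    by unfold_locales (use assms in auto)
  have lower_below: "\<exists>u w. u \<in> leaves S \<and> w \<in> inner_vertices (subtree_at T u) \<and> v = u @ w"
    if v: "v \<in> lower" for v
  proof -
    have "v \<in> vertices T"
      using v by (simp add: lower_def inner_vertices_def)
    then obtain u w where "u \<in> leaves S" "v = u @ w"
      using v by (cases rule: vertex_cases) (auto simp: lower_def)
    then show ?thesis
      using v by (auto simp: lower_def inner_vertices_def vertices_append_iff subtree_at_append)
  qed
  have separated: "stage T u \<noteq> stage T v" if "u \<in> inner_vertices S" "v \<in> lower" for u v
    using lower_below[OF that(2)] that(1) assms(4) by (auto simp: inner_vertices_def)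
  \<comment> \<open>The pivot position must be chosen per stage, so that the pivots are determined by labels alone.\<close>
  have "\<exists>i. \<forall>v\<in>lower. stage T v = s \<longrightarrow> i < num_children T v \<and>
      (\<forall>j<num_children T v. rooted_subtree (subtree_at T (v @ [i])) (subtree_at T (v @ [j])))" for s
  proof (cases "\<exists>v\<in>lower. stage T v = s")
    case True
    then obtain v where v: "v \<in> lower" "stage T v = s"
      by blast
    then obtain c where c: "s = Some c"
      by (cases "subtree_at T v") (auto simp: lower_def inner_vertices_def stage_def)
    then have "has_subtree_inclusion T c"
      using lower_below[OF v(1)] v(2) assms(5) by blast
    then show ?thesis
      unfolding has_subtree_inclusion_def lower_def inner_vertices_def c by blast
  qed blast
  then obtain idx where idx: "\<And>v. v \<in> lower \<Longrightarrow> idx (stage T v) < num_children T v"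
      "\<And>v j. v \<in> lower \<Longrightarrow> j < num_children T v \<Longrightarrow>
         rooted_subtree (subtree_at T (v @ [idx (stage T v)])) (subtree_at T (v @ [j]))"
    by metis
  define Piv where "Piv = {out_labels T v ! idx (stage T v) | v. v \<in> lower}"
  have PivD: "v \<in> lower" "i = idx (stage T v)"
    if v: "v \<in> inner_vertices T" "i < num_children T v" "out_labels T v ! i \<in> Piv" for v i
  proof -
    obtain u where u: "u \<in> lower" "out_labels T v ! i = out_labels T u ! idx (stage T u)"
      using v(3) by (auto simp: Piv_def)
    then have *: "stage T v = stage T u" "i = idx (stage T u)"
      using staged_tree_label_cases[OF staged_T v(1) _ v(2) idx(1)[OF u(1)]]
      by (auto simp: lower_def)
    then show "i = idx (stage T v)" "v \<in> lower"
      using separated[of v u] u(1) v(1) by (auto simp: lower_def)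
  qed
  interpret balanced_above_pivots T S Piv
  proof
    fix v i j assume v: "v \<in> inner_vertices T" "i < num_children T v" "j < num_children T v"
        "out_labels T v ! i \<in> Piv"
    show "i = j" if "out_labels T v ! j \<in> Piv"
      using PivD(2)[OF v(1,2,4)] PivD(2)[OF v(1,3) that] by simp
    show "rooted_subtree (subtree_at T (v @ [i])) (subtree_at T (v @ [j]))"
      using idx(2)[of v j] PivD[OF v(1,2,4)] v(3) by simp
  next
    fix v i assume "v \<in> inner_vertices S" "i < num_children T v"
    then show "out_labels T v ! i \<notin> Piv"
      using PivD(1)[of v i] inner_sub by (auto simp: lower_def)
  next
    fix v i assume v: "v \<in> lower" "i < num_children T v"
    show "out_labels T v ! i \<notin> label_set S"
    proof
      assume "out_labels T v ! i \<in> label_set S"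
      then obtain u j where u: "u \<in> inner_vertices S" "j < num_children T u"
          "out_labels T v ! i = out_labels T u ! j"
        using out_labels_S by (auto simp: label_set_def num_children_def in_set_conv_nth)
      then have "stage T v = stage T u"
        using staged_tree_label_cases(1)[OF staged_T _ _ v(2) u(2)] v inner_sub
        by (auto simp: lower_def)
      then show False
        using separated[OF u(1) v(1)] by simp
    qed
  next
    fix v assume "v \<in> lower"
    then show "\<exists>i<num_children T v. out_labels T v ! i \<in> Piv"
      using idx(1) by (auto simp: Piv_def)
  qed (use assms in auto)
  show ?thesis
    by (rule toric)
qed

end
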